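(* Let $B$ be a standard linear Brownian motion started at $0$, let $c\in\mathbb{R}$, and let $g_c=\sup\{t\in(0,1]:B_t=c\sqrt t\}$ (with $g_c=0$ if the set is empty). For $q>0$ and $x\in\mathbb{R}$ let $$H_q(x)=\int_0^\infty e^{-xz-z^2/2}z^{q-1}\,dz.$$ Then for every $q>0$ $$\mathbb{E}(g_c^q)=\frac{\Gamma(2q)}{2q\,H_{2q}(c)\,H_{2q}(-c)},$$ and $$\mathbb{E}(g_c^q)\sim\frac{e^{-c^2/2}}{\sqrt{\pi q}}\qquad\text{as } q\to\infty.$$
   Context: $\Gamma$ is the Gamma function; $a(q)\sim b(q)$ means $a(q)/b(q)\to1$. *)

theory Defs
  imports "HOL-Probability.Probability"
begin

text \<open>
  Path continuity and the starting value are required almost surely. The time index is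
  \<open>t \<ge> 0\<close>; values of \<open>B\<close> at negative times are unconstrained and irrelevant.
\<close>

locale standard_brownian_motion = prob_space M
  for M :: "'a measure" and B :: "real \<Rightarrow> 'a \<Rightarrow> real" +
  assumes random_variable_B: "\<And>t. 0 \<le> t \<Longrightarrow> B t \<in> borel_measurable M"
    and start_zero: "AE \<omega> in M. B 0 \<omega> = 0"
    and indep_increments:
      "\<And>(\<tau> :: nat \<Rightarrow> real) n. 0 \<le> \<tau> 0 \<Longrightarrow> (\<And>i. i < n \<Longrightarrow> \<tau> i \<le> \<tau> (Suc i)) \<Longrightarrow>
        indep_vars (\<lambda>_. borel) (\<lambda>i \<omega>. B (\<tau> (Suc i)) \<omega> - B (\<tau> i) \<omega>) {..<n}"
    and normal_increments:
      "\<And>s t. 0 \<le> s \<Longrightarrow> s < t \<Longrightarrow>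
        distributed M lborel (\<lambda>\<omega>. B t \<omega> - B s \<omega>)
          (\<lambda>x. ennreal (normal_density 0 (sqrt (t - s)) x))"
    and continuous_paths: "AE \<omega> in M. continuous_on {0..} (\<lambda>t. B t \<omega>)"

text \<open>
  The explicit case distinction is needed because \<open>Sup {}\<close> is unspecified on the reals; the
  set is bounded by 1, so otherwise \<open>Sup\<close> is the genuine supremum.
\<close>

definition last_crossing :: "(real \<Rightarrow> 'a \<Rightarrow> real) \<Rightarrow> real \<Rightarrow> 'a \<Rightarrow> real" where
  "last_crossing B c \<omega> =
    (let S = {t \<in> {0<..1}. B t \<omega> = c * sqrt t} in if S = {} then 0 else Sup S)"

definition H :: "real \<Rightarrow> real \<Rightarrow> real" where
  "H q x = (LBINT z:{0<..}. exp (- x * z - z\<^sup>2 / 2) * z powr (q - 1))"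

text \<open>
  As paths are continuous only almost surely, the last crossing time need not be
  \<open>M\<close>-measurable when \<open>M\<close> is not complete; it is measurable for the completion. Expectations
  are therefore taken there. For a complete \<open>M\<close>, or when the last crossing time is
  \<open>M\<close>-measurable (e.g. if every path is continuous), this is the expectation under \<open>M\<close>.
\<close>

definition last_crossing_moment ::
  "'a measure \<Rightarrow> (real \<Rightarrow> 'a \<Rightarrow> real) \<Rightarrow> real \<Rightarrow> real \<Rightarrow> real" where
  "last_crossing_moment M B c q = (LINT \<omega>|completion M. last_crossing B c \<omega> powr q)"

end

theory Submission
  imports Defs
begin

text \<open>
  For \<open>v > 0\<close>, weighting by \<open>exp (- v * B s / s - v\<^sup>2 / (2 * s))\<close> turns the path after time \<open>s\<close>
  into a Brownian motion started at \<open>- v\<close>. On the event \<open>c < B 1\<close> such a path has to cross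
  \<open>c * sqrt t\<close>, so summing over the possible values \<open>s\<close> of its last crossing time \<open>g\<close> (a function of
  the path after \<open>s\<close>) gives
  \<open>E [exp (- v * c / sqrt g - v\<^sup>2 / (2 * g)); c < B 1, 0 < g] = P (c + v < B 1)\<close>.
  Integrating against \<open>v powr (2 * q - 1)\<close> yields
  \<open>E [g powr q; c < B 1] = exp (- c\<^sup>2 / 2) / sqrt (2 * pi) / (2 * q) * H (2 * q + 1) c / H (2 * q) c\<close>.
  The part on \<open>B 1 < c\<close> follows by reflection. The closed form comes from the Wronskian of \<open>H p x\<close>
  and \<open>H p (- x)\<close>, and the asymptotics from \<open>H (p + 1) x / H p x \<sim> sqrt p\<close>, a consequence of the
  recurrence and of log-convexity in \<open>p\<close>.

  Sums over \<open>s\<close> only make sense on a grid, and a continuous path may touch the boundary from above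
  without the grid noticing. Two limits deal with this: first the mesh tends to 0 at a fixed level,
  then the level decreases to \<open>c\<close>.
\<close>

section \<open>The functions H\<close>

text \<open>Completing the square around \<open>1 - x\<close>. Domination by a multiple of
  \<open>exp (- z)\<close> reduces integrability and decay questions about \<open>H\<close> to the
  Gamma integral and to powers against \<open>exp z\<close>.\<close>

lemma exp_quadratic_le:
  fixes x z :: real
  shows "exp (- x * z - z\<^sup>2 / 2) \<le> exp ((1 - x)\<^sup>2 / 2) / exp z"
proof -
  have "0 \<le> (z - (1 - x))\<^sup>2 / 2" by simp
  then have "- x * z - z\<^sup>2 / 2 \<le> (1 - x)\<^sup>2 / 2 - z"
    by (simp add: power2_eq_square algebra_simps diff_divide_distrib add_divide_distrib)
  then show ?thesis by (simp flip: exp_diff)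
qed

lemma set_integrable_H:
  fixes q x :: real
  assumes "q > 0"
  shows "set_integrable lborel {0<..} (\<lambda>z. exp (- x * z - z\<^sup>2 / 2) * z powr (q - 1))"
proof -
  let ?g = "\<lambda>z::real. indicator {0..} z * z powr (q - 1) / exp z"
  have "(\<integral>\<^sup>+z. ennreal (?g z) \<partial>lborel) < \<infinity>"
    by (simp flip: Gamma_conv_nn_integral_real[OF assms])
  then have g: "integrable lborel ?g"
    by (intro integrableI_nonneg) auto
  show ?thesis
    unfolding set_integrable_def
  proof (rule Bochner_Integration.integrable_bound[OF integrable_mult_right[OF g, of "exp ((1 - x)\<^sup>2 / 2)"]])
    show "AE z in lborel. norm (indicat_real {0<..} z *\<^sub>R (exp (- x * z - z\<^sup>2 / 2) * z powr (q - 1)))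
        \<le> norm (exp ((1 - x)\<^sup>2 / 2) * ?g z)"
    proof (intro AE_I2)
      fix z :: real
      have "exp (- x * z - z\<^sup>2 / 2) \<le> exp ((1 - x)\<^sup>2 / 2) / exp z"
        by (rule exp_quadratic_le)
      then have "exp (- x * z - z\<^sup>2 / 2) * z powr (q - 1) \<le> exp ((1 - x)\<^sup>2 / 2) / exp z * z powr (q - 1)"
        by (rule mult_right_mono) simp
      then show "norm (indicat_real {0<..} z *\<^sub>R (exp (- x * z - z\<^sup>2 / 2) * z powr (q - 1)))
        \<le> norm (exp ((1 - x)\<^sup>2 / 2) * ?g z)"
        by (simp add: indicator_def abs_mult)
    qed
  qed simp
qed

lemma nn_integral_H:
  fixes q x :: real
  assumes "q > 0"
  shows "(\<integral>\<^sup>+z. ennreal (exp (- x * z - z\<^sup>2 / 2) * z powr (q - 1)) * indicator {0<..} z \<partial>lborel)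
    = ennreal (H q x)"
proof -
  have "(\<integral>\<^sup>+z. ennreal (exp (- x * z - z\<^sup>2 / 2) * z powr (q - 1)) * indicator {0<..} z \<partial>lborel)
    = (\<integral>\<^sup>+z. ennreal (indicator {0<..} z *\<^sub>R (exp (- x * z - z\<^sup>2 / 2) * z powr (q - 1))) \<partial>lborel)"
    by (intro nn_integral_cong) (simp add: indicator_def)
  also have "\<dots> = ennreal (H q x)"
    unfolding H_def set_lebesgue_integral_def
    by (rule nn_integral_eq_integral[OF set_integrable_H[OF assms, unfolded set_integrable_def]])
       (simp add: indicator_def)
  finally show ?thesis .
qed

lemma H_nonneg: "H q x \<ge> 0"
  unfolding H_def set_lebesgue_integral_def by (intro integral_nonneg_AE) (simp add: indicator_def)

lemma H_pos:
  assumes "q > 0"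
  shows "H q x > 0"
proof (rule ccontr)
  assume "\<not> H q x > 0"
  then have "(\<integral>\<^sup>+z. ennreal (exp (- x * z - z\<^sup>2 / 2) * z powr (q - 1)) * indicator {0<..} z \<partial>lborel) = 0"
    unfolding nn_integral_H[OF assms] using H_nonneg[of q x] by (simp add: ennreal_eq_0_iff)
  then have "AE z in lborel. ennreal (exp (- x * z - z\<^sup>2 / 2) * z powr (q - 1)) * indicator {0<..} z = 0"
    by (subst (asm) nn_integral_0_iff_AE) auto
  \<comment> \<open>The integrand is strictly positive on (0, 1), so its vanishing almost everywhere
    would make this interval a null set.\<close>
  then have "AE z in lborel. z \<notin> {0<..<1::real}"
    by eventually_elim (auto simp: indicator_def mult_le_0_iff not_le)
  then have "{0<..<1::real} \<in> null_sets lborel"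
    by (subst AE_iff_null_sets) auto
  then show False by (simp add: null_sets_def)
qed

text \<open>Integration by parts for \<open>z powr q * exp (- x * z - z\<^sup>2 / 2)\<close>, whose boundary terms vanish.\<close>

lemma H_recurrence:
  fixes q x :: real
  assumes "q > 0"
  shows "H (q + 2) x + x * H (q + 1) x = q * H q x"
proof -
  let ?e = "\<lambda>z::real. exp (- x * z - z\<^sup>2 / 2)"
  \<comment> \<open>This is the derivative of \<open>?e z * z powr q\<close>. Exponents such as
    \<open>q + 2 - 1\<close> stay unsimplified so that the three terms match the definition of
    \<open>H\<close> literally.\<close>
  define f where "f = (\<lambda>z. q * (?e z * z powr (q - 1)) - (?e z * z powr (q + 2 - 1) + x * (?e z * z powr (q + 1 - 1))))"
  note I = set_integrable_H[of q x] set_integrable_H[of "q+1" x] set_integrable_H[of "q+2" x]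
  have int: "set_integrable lborel {0<..} f"
    unfolding f_def using assms I by (intro set_integral_diff set_integral_add set_integrable_mult_right) auto
  have "(LBINT z=0..\<infinity>. f z) = 0 - 0"
  proof (rule interval_integral_FTC_integrable)
    fix z :: real assume "(0::ereal) < ereal z"
    then have z: "z > 0" by (simp add: zero_ereal_def)
    have p: "z powr (q - 1) * z = z powr q" "z powr (1 + q) = z powr q * z"
      using z by (simp_all add: powr_diff powr_add)
    show "((\<lambda>z. ?e z * z powr q) has_vector_derivative f z) (at z)"
      unfolding f_def has_real_derivative_iff_has_vector_derivative[symmetric]
      using z by (auto intro!: derivative_eq_intros simp: p algebra_simps)
    show "isCont f z" unfolding f_def using z by (intro continuous_intros) auto
  next
    show "set_integrable lborel (einterval 0 \<infinity>) f"
      using int by (simp add: zero_ereal_def)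
    have "((\<lambda>z::real. z powr q) \<longlongrightarrow> 0) (at_right 0)"
      using assms by (intro tendsto_zero_powrI[where b = q]) (auto simp: eventually_at_filter)
    moreover have "(?e \<longlongrightarrow> ?e 0) (at_right 0)"
      by (intro tendsto_intros) auto
    ultimately have "((\<lambda>z. ?e z * z powr q) \<longlongrightarrow> ?e 0 * 0) (at_right 0)"
      by (rule tendsto_mult[rotated])
    then show "(((\<lambda>z. ?e z * z powr q) \<circ> real_of_ereal) \<longlongrightarrow> 0) (at_right 0)"
      by (simp add: zero_ereal_def ereal_tendsto_simps)
    have "((\<lambda>z. ?e z * z powr q) \<longlongrightarrow> 0) at_top"
    proof (rule tendsto_sandwich[OF _ _ tendsto_const])
      \<comment> \<open>For \<open>z >= 1\<close> the real power is at most an integer power, for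
        which the comparison with \<open>exp z\<close> is known.\<close>
      define n where "n = nat \<lceil>q\<rceil>"
      have "((\<lambda>z::real. exp ((1 - x)\<^sup>2 / 2) * (z ^ n / exp z)) \<longlongrightarrow> exp ((1 - x)\<^sup>2 / 2) * 0) at_top"
        by (intro tendsto_intros tendsto_power_div_exp_0)
      then show "((\<lambda>z::real. exp ((1 - x)\<^sup>2 / 2) * (z ^ n / exp z)) \<longlongrightarrow> 0) at_top"
        by simp
      show "\<forall>\<^sub>F z in at_top. ?e z * z powr q \<le> exp ((1 - x)\<^sup>2 / 2) * (z ^ n / exp z)"
        using eventually_ge_at_top[of 1]
      proof eventually_elim
        case (elim z)
        have "z powr q \<le> z powr n"
          using elim real_nat_ceiling_ge[of q] by (intro powr_mono) (auto simp: n_def)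
        then have "z powr q \<le> z ^ n"
          using elim by (simp add: powr_realpow)
        then have "?e z * z powr q \<le> exp ((1 - x)\<^sup>2 / 2) / exp z * z ^ n"
          by (intro mult_mono exp_quadratic_le) auto
        then show ?case by simp
      qed
    qed simp
    then show "(((\<lambda>z. ?e z * z powr q) \<circ> real_of_ereal) \<longlongrightarrow> 0) (at_left \<infinity>)"
      by (simp add: ereal_tendsto_simps)
  qed simp
  also have "(LBINT z=0..\<infinity>. f z) = (LBINT z:{0<..}. f z)"
    by (simp add: interval_lebesgue_integral_def zero_ereal_def)
  also have "\<dots> = q * H q x - (H (q + 2) x + x * H (q + 1) x)"
    unfolding f_def H_def using I assms
    by (simp add: set_integral_diff set_integral_add)
  finally show ?thesis by simp
qed

text \<open>Cauchy-Schwarz for the moments of the weight \<open>?e z * z powr (q - 1)\<close>: the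
  integral of this weight times \<open>(z - r)\<^sup>2\<close> is nonnegative, and \<open>r\<close>
  is chosen as the mean, which makes the inequality sharpest.\<close>

lemma H_log_convex:
  fixes q x :: real
  assumes "q > 0"
  shows "(H (q + 1) x)\<^sup>2 \<le> H q x * H (q + 2) x"
proof -
  let ?e = "\<lambda>z::real. exp (- x * z - z\<^sup>2 / 2)"
  define r where "r = H (q + 1) x / H q x"
  note I = set_integrable_H[of q x] set_integrable_H[of "q+1" x] set_integrable_H[of "q+2" x]
  have "0 \<le> (LBINT z:{0<..}. ?e z * z powr (q + 2 - 1) + (r\<^sup>2 * (?e z * z powr (q - 1)) - 2 * r * (?e z * z powr (q + 1 - 1))))"
    unfolding set_lebesgue_integral_def
  proof (intro integral_nonneg_AE AE_I2)
    fix z :: real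
    have "?e z * z powr (q + 2 - 1) + (r\<^sup>2 * (?e z * z powr (q - 1)) - 2 * r * (?e z * z powr (q + 1 - 1)))
      = ?e z * z powr (q - 1) * (z - r)\<^sup>2" if "z > 0"
    proof -
      have "z powr (q + 2 - 1) = z powr (q - 1) * z\<^sup>2" "z powr (q + 1 - 1) = z powr (q - 1) * z"
        using that by (simp_all add: powr_diff powr_add power2_eq_square)
      then show ?thesis by (simp add: power2_eq_square algebra_simps)
    qed
    then show "0 \<le> indicat_real {0<..} z *\<^sub>R (?e z * z powr (q + 2 - 1) + (r\<^sup>2 * (?e z * z powr (q - 1)) - 2 * r * (?e z * z powr (q + 1 - 1))))"
      by (simp add: indicator_def)
  qed
  also have "\<dots> = H (q + 2) x + (r\<^sup>2 * H q x - 2 * r * H (q + 1) x)"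
    unfolding H_def using I assms by (simp add: set_integral_diff set_integral_add)
  also have "\<dots> = H (q + 2) x - (H (q + 1) x)\<^sup>2 / H q x"
    using H_pos[OF assms, of x] by (simp add: r_def field_simps power2_eq_square)
  finally have "(H (q + 1) x)\<^sup>2 / H q x \<le> H (q + 2) x" by simp
  then show ?thesis using H_pos[OF assms, of x] by (simp add: pos_divide_le_eq mult.commute)
qed

section \<open>The Wronskian of \<open>H p x\<close> and \<open>H p (- x)\<close>\<close>

lemma Gamma_has_integral_greaterThan:
  assumes "p > (0::real)"
  shows "((\<lambda>s. s powr (p - 1) / exp s) has_integral Gamma p) {0<..}"
proof -
  have "((\<lambda>s. if s \<in> {0<..} then s powr (p - 1) / exp s else 0) has_integral Gamma p) {0..}"
    by (rule has_integral_spike[OF _ _ Gamma_integral_real[OF assms], of "{0}"]) auto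
  then show ?thesis by (subst (asm) has_integral_restrict) auto
qed

text \<open>Substitution \<open>s = x * (x + a)\<close> in the Gamma integral, an increasing
  bijection of the positive half-line with derivative \<open>2 * x + a\<close>. In the Wronskian
  \<open>a\<close> is the distance of the two variables, \<open>x\<close> the smaller one,
  \<open>s\<close> their product and \<open>2 * x + a\<close> their sum.\<close>

lemma nn_integral_Gamma_substitution:
  fixes p a :: real
  assumes "p > 0" "a \<ge> 0"
  shows "(\<integral>\<^sup>+x. ennreal ((x * (x + a)) powr (p - 1) / exp (x * (x + a)) * (2 * x + a)) * indicator {0<..} x \<partial>lborel)
    = ennreal (Gamma p)"
proof -
  let ?F = "\<lambda>s::real. s powr (p - 1) / exp s" and ?g = "\<lambda>x. x * (x + a)"
  have img: "?g ` {0<..} = {0<..}"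
  proof (intro equalityI subsetI)
    fix s :: real assume s: "s \<in> {0<..}"
    \<comment> \<open>The positive root of \<open>x\<^sup>2 + a * x = s\<close>.\<close>
    let ?x = "(sqrt (a\<^sup>2 + 4 * s) - a) / 2"
    have "a < sqrt (a\<^sup>2 + 4 * s)"
      using s assms by (intro real_less_rsqrt) auto
    moreover have "?g ?x = ((sqrt (a\<^sup>2 + 4 * s))\<^sup>2 - a\<^sup>2) / 4"
      by (simp add: power2_eq_square field_simps)
    then have "?g ?x = s"
      using s by (simp add: real_sqrt_pow2)
    ultimately show "s \<in> ?g ` {0<..}"
      by (intro image_eqI[of _ _ ?x]) auto
  qed (use assms in \<open>auto intro!: mult_pos_pos add_pos_nonneg\<close>)
  have inj: "inj_on ?g {0<..}"
  proof (rule linorder_inj_onI)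
    fix x y :: real assume "x < y" "x \<in> {0<..}" "y \<in> {0<..}"
    then have "?g x < ?g y" using assms by (intro mult_strict_mono) auto
    then show "?g x \<noteq> ?g y" by simp
  qed auto
  have "?F absolutely_integrable_on {0<..} \<and> integral {0<..} ?F = Gamma p"
    using Gamma_has_integral_greaterThan[OF assms(1)]
    by (auto intro!: nonnegative_absolutely_integrable_1 simp: integral_unique has_integral_integrable)
  then have *: "(\<lambda>x. \<bar>2 * x + a\<bar> * ?F (?g x)) absolutely_integrable_on {0<..} \<and>
      integral {0<..} (\<lambda>x. \<bar>2 * x + a\<bar> * ?F (?g x)) = Gamma p"
    by (subst has_absolute_integral_change_of_variables_1'[OF _ _ inj])
       (auto simp: img intro!: derivative_eq_intros)
  then have "((\<lambda>x. \<bar>2 * x + a\<bar> * ?F (?g x)) has_integral Gamma p) {0<..}"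
    by (auto simp: has_integral_integrable_integral absolutely_integrable_on_def)
  then have "(\<integral>\<^sup>+x. ennreal (\<bar>2 * x + a\<bar> * ?F (?g x)) * indicator {0<..} x \<partial>lborel) = ennreal (Gamma p)"
    by (intro nn_integral_has_integral_lebesgue') auto
  also have "(\<integral>\<^sup>+x. ennreal (\<bar>2 * x + a\<bar> * ?F (?g x)) * indicator {0<..} x \<partial>lborel) =
      (\<integral>\<^sup>+x. ennreal (?F (?g x) * (2 * x + a)) * indicator {0<..} x \<partial>lborel)"
    using assms by (intro nn_integral_cong) (auto simp: indicator_def mult.commute)
  finally show ?thesis .
qed

lemma nn_integral_exp_quadratic:
  fixes c :: real
  shows "(\<integral>\<^sup>+d. ennreal (exp (- c * d - d\<^sup>2 / 2)) \<partial>lborel) = ennreal (sqrt (2 * pi) * exp (c\<^sup>2 / 2))"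
proof -
  have "exp (- c * d - d\<^sup>2 / 2) = sqrt (2 * pi) * exp (c\<^sup>2 / 2) * normal_density (- c) 1 d" for d
    by (simp add: normal_density_def flip: exp_add)
       (simp add: power2_eq_square field_simps)
  then have "(\<integral>\<^sup>+d. ennreal (exp (- c * d - d\<^sup>2 / 2)) \<partial>lborel)
      = (\<integral>\<^sup>+d. ennreal (sqrt (2 * pi) * exp (c\<^sup>2 / 2)) * ennreal (normal_density (- c) 1 d) \<partial>lborel)"
    by (simp add: ennreal_mult)
  also have "\<dots> = ennreal (sqrt (2 * pi) * exp (c\<^sup>2 / 2)) * (\<integral>\<^sup>+d. ennreal (normal_density (- c) 1 d) \<partial>lborel)"
    by (rule nn_integral_cmult) auto
  also have "(\<integral>\<^sup>+d. ennreal (normal_density (- c) 1 d) \<partial>lborel) = 1"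
    by (subst nn_integral_eq_integral) auto
  finally show ?thesis by simp
qed

text \<open>
  As \<open>H p\<close> has derivative \<open>- H (p + 1)\<close>, the left-hand side is up to sign the Wronskian of the solutions
  \<open>H p x\<close> and \<open>H p (- x)\<close> of \<open>f'' - x f' = p f\<close>. It is evaluated by writing it as a double
  integral over \<open>z, w > 0\<close> and passing to the coordinates \<open>d = z - w\<close> and \<open>s = z * w\<close>, whose
  Jacobian is \<open>z + w\<close>.
\<close>

lemma H_wronskian:
  fixes p c :: real
  assumes p: "p > 0"
  shows "H (p + 1) c * H p (- c) + H (p + 1) (- c) * H p c = sqrt (2 * pi) * exp (c\<^sup>2 / 2) * Gamma p"
proof -
  define h where "h c p z = ennreal (exp (- c * z - z\<^sup>2 / 2) * z powr (p - 1)) * indicator {0<..} z" for c p z :: real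
  have [measurable]: "h c p \<in> borel_measurable borel" for c p
    unfolding h_def by measurable
  have hH: "(\<integral>\<^sup>+z. h c p z \<partial>lborel) = ennreal (H p c)" if "p > 0" for c p
    unfolding h_def using that by (rule nn_integral_H)
  have prod: "(\<integral>\<^sup>+z. \<integral>\<^sup>+w. h c p z * h c' p' w \<partial>lborel \<partial>lborel) = ennreal (H p c * H p' c')"
    if "p > 0" "p' > 0" for c p c' p'
    using that by (simp add: nn_integral_cmult nn_integral_multc hH ennreal_mult H_nonneg)
  define F where "F s = s powr (p - 1) / exp s" for s :: real
  define e where "e d = exp (- c * d - d\<^sup>2 / 2)" for d
  have e_nonneg: "0 \<le> e d" for d
    by (simp add: e_def)
  define K where "K z w = ennreal (e (z - w) * (F (z * w) * (z + w))) * (indicator {0<..} z * indicator {0<..} w)" for z w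
  have [measurable]: "F \<in> borel_measurable borel" "e \<in> borel_measurable borel"
    unfolding F_def e_def by measurable
  have K: "h c (p + 1) z * h (- c) p w + h c p z * h (- c) (p + 1) w = K z w" for z w
  proof (cases "z > 0 \<and> w > 0")
    case True
    \<comment> \<open>Since
      \<open>(z\<^sup>2 + w\<^sup>2) / 2 = (z - w)\<^sup>2 / 2 + z * w\<close>, the two weights
      multiply to a function of the difference times one of the product.\<close>
    have ex: "exp (- c * z - z\<^sup>2 / 2) * exp (- (- c) * w - w\<^sup>2 / 2) = e (z - w) / exp (z * w)"
      unfolding e_def by (simp add: power2_eq_square field_simps flip: exp_diff exp_add)
    have "exp (- c * z - z\<^sup>2 / 2) * z powr (p + 1 - 1) * (exp (- (- c) * w - w\<^sup>2 / 2) * w powr (p - 1))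
       + exp (- c * z - z\<^sup>2 / 2) * z powr (p - 1) * (exp (- (- c) * w - w\<^sup>2 / 2) * w powr (p + 1 - 1))
       = (exp (- c * z - z\<^sup>2 / 2) * exp (- (- c) * w - w\<^sup>2 / 2)) * ((z * w) powr (p - 1) * (z + w))"
      using True by (simp add: powr_mult powr_diff field_simps)
    also have "\<dots> = e (z - w) * (F (z * w) * (z + w))"
      unfolding ex F_def by simp
    finally show ?thesis
      using True by (simp add: h_def K_def flip: ennreal_mult' ennreal_plus)
  qed (auto simp: h_def K_def)
  have [measurable]: "(\<lambda>(z, w). K z w) \<in> borel_measurable (borel \<Otimes>\<^sub>M borel)"
    unfolding K_def by measurable
  have J: "(\<integral>\<^sup>+w. K (w + d) w \<partial>lborel) = ennreal (e d) * ennreal (Gamma p)" for d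
  proof -
    \<comment> \<open>With \<open>w = m + x\<close>, the variable \<open>x\<close> is the smaller of
      \<open>w\<close> and \<open>w + d\<close>. Hence both are positive exactly when
      \<open>x > 0\<close>, and their product and sum depend on \<open>d\<close> only through its
      absolute value.\<close>
    define m where "m = max 0 (- d)"
    have "(\<integral>\<^sup>+w. K (w + d) w \<partial>lborel) = (\<integral>\<^sup>+x. K (m + 1 * x + d) (m + 1 * x) \<partial>lborel)"
      by (subst nn_integral_real_affine[where c = 1 and t = m]) auto
    also have "\<dots> = (\<integral>\<^sup>+x. ennreal (e d) * (ennreal (F (x * (x + \<bar>d\<bar>)) * (2 * x + \<bar>d\<bar>)) * indicator {0<..} x) \<partial>lborel)"
    proof (intro nn_integral_cong)
      fix x :: real
      show "K (m + 1 * x + d) (m + 1 * x) =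
          ennreal (e d) * (ennreal (F (x * (x + \<bar>d\<bar>)) * (2 * x + \<bar>d\<bar>)) * indicator {0<..} x)"
      proof -
        have "m + 1 * x + d - (m + 1 * x) = d" "(m + 1 * x + d) * (m + 1 * x) = x * (x + \<bar>d\<bar>)"
            "m + 1 * x + d + (m + 1 * x) = 2 * x + \<bar>d\<bar>"
          by (simp_all add: m_def max_def abs_if algebra_simps)
        moreover have "indicator {0<..} (m + 1 * x + d) * indicator {0<..} (m + 1 * x) = (indicator {0<..} x :: ennreal)"
          by (auto simp: m_def max_def indicator_def)
        ultimately show ?thesis
          unfolding K_def by (simp only: ennreal_mult'[OF e_nonneg] mult.assoc)
      qed
    qed
    also have "\<dots> = ennreal (e d) * ennreal (Gamma p)"
      using nn_integral_Gamma_substitution[OF p, of "\<bar>d\<bar>"]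
      by (simp add: nn_integral_cmult F_def)
    finally show ?thesis .
  qed
  have "ennreal (H (p + 1) c * H p (- c) + H (p + 1) (- c) * H p c)
      = ennreal (H (p + 1) c * H p (- c)) + ennreal (H p c * H (p + 1) (- c))"
    by (simp add: H_nonneg mult.commute)
  also have "\<dots> = (\<integral>\<^sup>+z. \<integral>\<^sup>+w. K z w \<partial>lborel \<partial>lborel)"
    using p by (simp add: nn_integral_add flip: prod K)
  also have "\<dots> = (\<integral>\<^sup>+w. \<integral>\<^sup>+z. K z w \<partial>lborel \<partial>lborel)"
    by (rule lborel_pair.Fubini') simp
  also have "\<dots> = (\<integral>\<^sup>+w. \<integral>\<^sup>+d. K (w + 1 * d) w \<partial>lborel \<partial>lborel)"
  proof (rule nn_integral_cong)
    fix w :: real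
    show "(\<integral>\<^sup>+z. K z w \<partial>lborel) = (\<integral>\<^sup>+d. K (w + 1 * d) w \<partial>lborel)"
      by (subst nn_integral_real_affine[where c = 1 and t = w]) auto
  qed
  also have "\<dots> = (\<integral>\<^sup>+d. \<integral>\<^sup>+w. K (w + d) w \<partial>lborel \<partial>lborel)"
    by (subst lborel_pair.Fubini') auto
  also have "\<dots> = ennreal (sqrt (2 * pi) * exp (c\<^sup>2 / 2)) * ennreal (Gamma p)"
    unfolding J e_def by (subst nn_integral_multc) (auto simp only: nn_integral_exp_quadratic, measurable)
  also have "\<dots> = ennreal (sqrt (2 * pi) * exp (c\<^sup>2 / 2) * Gamma p)"
    using p by (intro ennreal_mult[symmetric]) auto
  finally show ?thesis
    using p by (subst (asm) ennreal_inj) (auto simp: H_nonneg intro!: add_nonneg_nonneg mult_nonneg_nonneg)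
qed

section \<open>Scaling, and growth of the ratios \<open>H (p + 1) x / H p x\<close>\<close>

text \<open>Substitution \<open>v = sqrt g * z\<close>. For \<open>p = 2 * q\<close> the scaling
  factor becomes \<open>g powr q\<close>, which is how moments of the crossing time arise from the
  exponential weights.\<close>

lemma nn_integral_H_scaled:
  fixes g p c :: real
  assumes "g > 0" "p > 0"
  shows "(\<integral>\<^sup>+v. ennreal (v powr (p - 1) * exp (- v * c / sqrt g - v\<^sup>2 / (2 * g))) * indicator {0<..} v \<partial>lborel)
    = ennreal (g powr (p / 2) * H p c)"
proof -
  have "(\<integral>\<^sup>+v. ennreal (v powr (p - 1) * exp (- v * c / sqrt g - v\<^sup>2 / (2 * g))) * indicator {0<..} v \<partial>lborel)
    = ennreal (sqrt g) * (\<integral>\<^sup>+z. ennreal ((0 + sqrt g * z) powr (p - 1) * exp (- (0 + sqrt g * z) * c / sqrt g - (0 + sqrt g * z)\<^sup>2 / (2 * g))) * indicator {0<..} (0 + sqrt g * z) \<partial>lborel)"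
    using assms by (subst nn_integral_real_affine[where c = "sqrt g" and t = 0]) auto
  also have "\<dots> = (\<integral>\<^sup>+z. ennreal (sqrt g) * (ennreal ((0 + sqrt g * z) powr (p - 1) * exp (- (0 + sqrt g * z) * c / sqrt g - (0 + sqrt g * z)\<^sup>2 / (2 * g))) * indicator {0<..} (0 + sqrt g * z)) \<partial>lborel)"
    by (rule nn_integral_cmult[symmetric]) measurable
  also have "\<dots> = (\<integral>\<^sup>+z. ennreal (g powr (p / 2)) * (ennreal (exp (- c * z - z\<^sup>2 / 2) * z powr (p - 1)) * indicator {0<..} z) \<partial>lborel)"
  proof (intro nn_integral_cong)
    fix z :: real
    have ind: "indicator {0<..} (0 + sqrt g * z) = (indicator {0<..} z :: ennreal)"
      using assms by (simp add: indicator_def zero_less_mult_iff)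
    have "sqrt g * ((sqrt g * z) powr (p - 1) * exp (- (sqrt g * z) * c / sqrt g - (sqrt g * z)\<^sup>2 / (2 * g)))
      = g powr (p / 2) * (exp (- c * z - z\<^sup>2 / 2) * z powr (p - 1))" if "z > 0"
    proof -
      have "sqrt g * (sqrt g * z) powr (p - 1) = g powr (p / 2) * z powr (p - 1)"
        using assms that by (simp add: powr_half_sqrt[symmetric] powr_mult powr_powr powr_diff diff_divide_distrib)
      moreover have "- (sqrt g * z) * c / sqrt g - (sqrt g * z)\<^sup>2 / (2 * g) = - c * z - z\<^sup>2 / 2"
        using assms by (simp add: power_mult_distrib)
      ultimately show ?thesis by (metis mult.assoc mult.commute)
    qed
    then show "ennreal (sqrt g) * (ennreal ((0 + sqrt g * z) powr (p - 1) * exp (- (0 + sqrt g * z) * c / sqrt g - (0 + sqrt g * z)\<^sup>2 / (2 * g))) * indicator {0<..} (0 + sqrt g * z))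
      = ennreal (g powr (p / 2)) * (ennreal (exp (- c * z - z\<^sup>2 / 2) * z powr (p - 1)) * indicator {0<..} z)"
      unfolding ind using assms by (auto simp: indicator_def simp flip: ennreal_mult')
  qed
  also have "\<dots> = ennreal (g powr (p / 2)) * ennreal (H p c)"
    using nn_integral_H[OF assms(2), of c] by (subst nn_integral_cmult) auto
  finally show ?thesis by (simp add: ennreal_mult H_nonneg)
qed

text \<open>For the ratio \<open>R\<close>, the recurrence reads
  \<open>R (p + 1) * R p + x * R p = p\<close>, and log-convexity says that \<open>R\<close> does
  not decrease under unit steps. Replacing \<open>R (p + 1)\<close> by \<open>R p\<close> gives a
  quadratic inequality for the upper bound; the recurrence at \<open>p - 1\<close>, with
  \<open>R (p - 1)\<close> replaced by \<open>R p\<close>, gives the lower one.\<close>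

lemma H_ratio_bounds:
  fixes p x :: real
  assumes "p > 1"
  shows "sqrt (p - 1) - \<bar>x\<bar> \<le> H (p + 1) x / H p x" "H (p + 1) x / H p x \<le> sqrt p + \<bar>x\<bar>"
proof -
  define R where "R p = H (p + 1) x / H p x" for p
  have pos: "R p > 0" if "p > 0" for p
    using that H_pos[of p x] H_pos[of "p + 1" x] by (simp add: R_def)
  have rec: "R (p + 1) * R p + x * R p = p" if "p > 0" for p
  proof -
    have "R (p + 1) * R p + x * R p = (H (p + 2) x + x * H (p + 1) x) / H p x"
      using that H_pos[of p x] H_pos[of "p + 1" x] by (simp add: R_def field_simps)
    then show ?thesis using H_recurrence[OF that, of x] H_pos[OF that, of x] by simp
  qed
  have mono: "R p \<le> R (p + 1)" if "p > 0" for p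
    using that H_log_convex[of p x] H_pos[of p x] H_pos[of "p + 1" x]
    by (simp add: R_def divide_simps power2_eq_square add.assoc mult.commute)
  have "R p * R p \<le> R (p + 1) * R p"
    using mono[of p] pos[of p] assms by (intro mult_right_mono) auto
  then have "R p * R p + x * R p \<le> p"
    using rec[of p] assms by linarith
  then have "(R p + x / 2)\<^sup>2 \<le> p + x\<^sup>2 / 4"
    by (simp add: power2_eq_square algebra_simps)
  also have "\<dots> \<le> (sqrt p + \<bar>x\<bar> / 2)\<^sup>2"
    using assms by (simp add: power2_sum power_divide)
  finally have "R p + x / 2 \<le> sqrt p + \<bar>x\<bar> / 2"
    by (rule power2_le_imp_le) (use assms in simp)
  then show "H (p + 1) x / H p x \<le> sqrt p + \<bar>x\<bar>"
    unfolding R_def by (simp add: abs_if split: if_splits)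
  have "p - 1 = R p * R (p - 1) + x * R (p - 1)"
    using rec[of "p - 1"] assms by simp
  also have "\<dots> \<le> R p * R p + \<bar>x\<bar> * R p"
    using mono[of "p - 1"] pos[of p] pos[of "p - 1"] assms
    by (intro add_mono mult_mono) auto
  also have "\<dots> \<le> (R p + \<bar>x\<bar>)\<^sup>2"
    using pos[of p] assms by (simp add: power2_eq_square algebra_simps)
  finally have "sqrt (p - 1) \<le> R p + \<bar>x\<bar>"
    using pos[of p] assms by (intro real_le_lsqrt) auto
  then show "sqrt (p - 1) - \<bar>x\<bar> \<le> H (p + 1) x / H p x"
    unfolding R_def by simp
qed

lemma H_ratio_asymptotics:
  "((\<lambda>p. H (p + 1) x / H p x / sqrt p) \<longlongrightarrow> 1) at_top"
proof -
  have "((\<lambda>p. H (p + 1) x / H p x / sqrt p - 1) \<longlongrightarrow> 0) at_top"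
  proof (rule Lim_null_comparison)
    show "\<forall>\<^sub>F p in at_top. norm (H (p + 1) x / H p x / sqrt p - 1) \<le> (\<bar>x\<bar> + 1) / sqrt p"
      using eventually_gt_at_top[of 1]
    proof eventually_elim
      case (elim p)
      have "sqrt p \<le> sqrt (p - 1) + sqrt 1"
        using elim sqrt_add_le_add_sqrt[of "p - 1" 1] by simp
      then have "\<bar>H (p + 1) x / H p x - sqrt p\<bar> \<le> \<bar>x\<bar> + 1"
        using H_ratio_bounds[OF elim, of x] by (simp add: abs_le_iff)
      then have "\<bar>H (p + 1) x / H p x - sqrt p\<bar> / sqrt p \<le> (\<bar>x\<bar> + 1) / sqrt p"
        using elim by (intro divide_right_mono) auto
      also have "\<bar>H (p + 1) x / H p x - sqrt p\<bar> / sqrt p = norm (H (p + 1) x / H p x / sqrt p - 1)"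
        using elim abs_divide[of "H (p + 1) x / H p x - sqrt p" "sqrt p"]
        by (simp add: diff_divide_distrib)
      finally show ?case .
    qed
    show "((\<lambda>p. (\<bar>x\<bar> + 1) / sqrt p) \<longlongrightarrow> 0) at_top"
      by (intro real_tendsto_divide_at_top[OF tendsto_const] sqrt_at_top)
  qed
  then show ?thesis by (simp add: LIM_zero_iff)
qed

section \<open>Crossings on dyadic grids\<close>

text \<open>An inequality is tested because a grid usually misses the exact crossing times. The
  value 0 is the default when no positive grid point qualifies; the index \<open>k = 0\<close>
  contributes it in any case, so the maximum is over a nonempty set.\<close>

definition grid_last :: "nat \<Rightarrow> real \<Rightarrow> (real \<Rightarrow> real) \<Rightarrow> real" where
  "grid_last n c b =
    Max ((\<lambda>k. if b (real k / 2 ^ n) \<le> c * sqrt (real k / 2 ^ n) then real k / 2 ^ n else 0) ` {..2 ^ n})"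

text \<open>Dyadic grids are nested, so this is the limit of an increasing sequence bounded by 1. It
  may lie strictly before the last crossing, since a path that touches the boundary from above at a
  non-dyadic time can go unnoticed.\<close>

definition crossing_lim :: "real \<Rightarrow> (real \<Rightarrow> real) \<Rightarrow> real" where
  "crossing_lim c b = lim (\<lambda>n. grid_last n c b)"

lemma grid_last_ge:
  assumes "k \<le> 2 ^ n" "b (real k / 2 ^ n) \<le> c * sqrt (real k / 2 ^ n)"
  shows "real k / 2 ^ n \<le> grid_last n c b"
  unfolding grid_last_def using assms by (intro Max_ge) (auto intro!: image_eqI[of _ _ k])

lemma grid_last_cases:
  obtains k where "k \<le> 2 ^ n" "grid_last n c b = real k / 2 ^ n"
    "k = 0 \<or> b (real k / 2 ^ n) \<le> c * sqrt (real k / 2 ^ n)"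
proof -
  let ?f = "\<lambda>k. if b (real k / 2 ^ n) \<le> c * sqrt (real k / 2 ^ n) then real k / 2 ^ n else 0"
  have "grid_last n c b \<in> ?f ` {..2 ^ n}"
    unfolding grid_last_def by (intro Max_in) auto
  then obtain k where k: "k \<le> 2 ^ n" "grid_last n c b = ?f k"
    by auto
  show ?thesis
    by (cases "b (real k / 2 ^ n) \<le> c * sqrt (real k / 2 ^ n)") (use k that[of k] that[of 0] in auto)
qed

lemma grid_last_nonneg: "0 \<le> grid_last n c b"
  by (rule grid_last_cases[of n c b]) auto

lemma grid_last_le_1: "grid_last n c b \<le> 1"
proof (rule grid_last_cases[of n c b])
  fix k assume "k \<le> 2 ^ n" "grid_last n c b = real k / 2 ^ n"
  moreover have "real k \<le> 2 ^ n"
    using \<open>k \<le> 2 ^ n\<close> by (metis of_nat_le_iff of_nat_numeral of_nat_power)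
  ultimately show ?thesis by simp
qed

lemma grid_last_below:
  assumes "grid_last n c b > 0"
  shows "b (grid_last n c b) \<le> c * sqrt (grid_last n c b)"
  by (rule grid_last_cases[of n c b]) (use assms in auto)

text \<open>Time 1 is itself a grid point and lies above the boundary, so the last grid crossing has
  a successor on the grid, and by maximality the path is above the boundary there. This is the upper
  half of the squeeze in \<open>crossing_lim_eq\<close>.\<close>

lemma grid_last_next:
  assumes "b 1 > c"
  shows "grid_last n c b + 1 / 2 ^ n \<le> 1"
    and "b (grid_last n c b + 1 / 2 ^ n) > c * sqrt (grid_last n c b + 1 / 2 ^ n)"
proof -
  obtain k where k: "k \<le> 2 ^ n" "grid_last n c b = real k / 2 ^ n"
    "k = 0 \<or> b (real k / 2 ^ n) \<le> c * sqrt (real k / 2 ^ n)"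
    by (rule grid_last_cases)
  have "k \<noteq> 2 ^ n"
    using k(3) assms by auto
  then have k1: "Suc k \<le> 2 ^ n"
    using k(1) by simp
  then have "real (Suc k) \<le> 2 ^ n"
    by (metis of_nat_le_iff of_nat_numeral of_nat_power)
  then show "grid_last n c b + 1 / 2 ^ n \<le> 1"
    by (simp add: k(2) field_simps)
  have eq: "grid_last n c b + 1 / 2 ^ n = real (Suc k) / 2 ^ n"
    by (simp add: k(2) field_simps)
  show "b (grid_last n c b + 1 / 2 ^ n) > c * sqrt (grid_last n c b + 1 / 2 ^ n)"
  proof (rule ccontr)
    assume "\<not> ?thesis"
    then have "real (Suc k) / 2 ^ n \<le> grid_last n c b"
      unfolding eq using k1 by (intro grid_last_ge) auto
    then show False by (simp add: k(2) divide_simps)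
  qed
qed

lemma incseq_grid_last: "incseq (\<lambda>n. grid_last n c b)"
proof (rule incseq_SucI)
  fix n
  obtain k where k: "k \<le> 2 ^ n" "grid_last n c b = real k / 2 ^ n"
    "k = 0 \<or> b (real k / 2 ^ n) \<le> c * sqrt (real k / 2 ^ n)"
    by (rule grid_last_cases)
  have eq: "real (2 * k) / 2 ^ Suc n = real k / 2 ^ n" by simp
  show "grid_last n c b \<le> grid_last (Suc n) c b"
  proof (cases "k = 0")
    case True
    then show ?thesis by (simp add: k(2) grid_last_nonneg)
  next
    case False
    then have "real (2 * k) / 2 ^ Suc n \<le> grid_last (Suc n) c b"
      using k by (intro grid_last_ge) (simp_all only: eq, simp_all)
    then show ?thesis by (simp add: k(2))
  qed
qed

lemma grid_last_LIMSEQ: "(\<lambda>n. grid_last n c b) \<longlonglongrightarrow> crossing_lim c b"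
  unfolding crossing_lim_def
  using incseq_convergent[OF incseq_grid_last, of c b 1] grid_last_le_1
  by (metis limI)

lemma grid_last_le_crossing_lim: "grid_last n c b \<le> crossing_lim c b"
  by (rule incseq_le[OF incseq_grid_last grid_last_LIMSEQ])

lemma crossing_lim_nonneg: "0 \<le> crossing_lim c b"
  using grid_last_le_crossing_lim[of 0 c b] grid_last_nonneg[of 0 c b] by linarith

lemma crossing_lim_le:
  assumes "\<And>n. grid_last n c b \<le> y"
  shows "crossing_lim c b \<le> y"
  by (rule LIMSEQ_le_const2[OF grid_last_LIMSEQ]) (use assms in auto)

text \<open>A strict inequality at \<open>t\<close> survives at nearby times by continuity, hence at
  the dyadic approximations of \<open>t\<close> from below once the mesh is small. Mere contact at
  \<open>t\<close> would not suffice.\<close>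

lemma crossing_lim_ge:
  assumes cont: "continuous_on {0..1} b" and t: "0 < t" "t < 1" "b t < c * sqrt t"
  shows "t \<le> crossing_lim c b"
proof -
  define s where "s n = real (nat \<lfloor>t * 2 ^ n\<rfloor>) / 2 ^ n" for n :: nat
  have s_le: "s n \<le> t" and s_ge: "t - 1 / 2 ^ n \<le> s n" for n
  proof -
    have "real (nat \<lfloor>t * 2 ^ n\<rfloor>) / 2 ^ n \<le> t * 2 ^ n / 2 ^ n"
      "(t * 2 ^ n - 1) / 2 ^ n \<le> real (nat \<lfloor>t * 2 ^ n\<rfloor>) / 2 ^ n"
      using t floor_correct[of "t * 2 ^ n"] by (intro divide_right_mono; simp)+
    then show "s n \<le> t" "t - 1 / 2 ^ n \<le> s n"
      by (simp_all add: s_def diff_divide_distrib)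
  qed
  have "(\<lambda>n. t - 1 / 2 ^ n) \<longlonglongrightarrow> t - 0"
    by (intro tendsto_intros LIMSEQ_divide_realpow_zero) simp
  then have s: "s \<longlonglongrightarrow> t"
    by (intro tendsto_sandwich[OF _ _ _ tendsto_const, of _ s _ t]) (auto simp: s_le s_ge)
  have s01: "s n \<in> {0..1}" for n
  proof -
    have "0 \<le> s n" by (simp add: s_def)
    then show ?thesis using s_le[of n] t by simp
  qed
  have "(\<lambda>n. b (s n) - c * sqrt (s n)) \<longlonglongrightarrow> b t - c * sqrt t"
    using t s01 by (intro tendsto_intros continuous_on_tendsto_compose[OF cont s] s) auto
  then have "\<forall>\<^sub>F n in sequentially. b (s n) - c * sqrt (s n) < 0"
    by (rule order_tendstoD) (use t in simp)
  then have "\<forall>\<^sub>F n in sequentially. s n \<le> crossing_lim c b"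
  proof eventually_elim
    case (elim n)
    have "real (nat \<lfloor>t * 2 ^ n\<rfloor>) \<le> 2 ^ n"
      using s01[of n] by (simp add: s_def)
    then have "nat \<lfloor>t * 2 ^ n\<rfloor> \<le> 2 ^ n"
      by (metis of_nat_le_iff of_nat_numeral of_nat_power)
    then have "s n \<le> grid_last n c b"
      using elim unfolding s_def by (intro grid_last_ge) auto
    then show ?case
      using grid_last_le_crossing_lim[of n c b] by linarith
  qed
  then show ?thesis
    by (rule tendsto_upperbound[OF s]) simp
qed

text \<open>At \<open>grid_last n c b\<close> the path is on or below the boundary, one mesh width
  later it is above. Both times converge to the same limit, where continuity forces
  equality.\<close>

lemma crossing_lim_eq:
  assumes cont: "continuous_on {0..1} b" and b1: "b 1 > c" and pos: "crossing_lim c b > 0"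
  shows "b (crossing_lim c b) = c * sqrt (crossing_lim c b)"
proof (rule antisym)
  let ?G = "crossing_lim c b"
  have G1: "?G \<le> 1"
    by (intro crossing_lim_le grid_last_le_1)
  note lim = grid_last_LIMSEQ[of c b]
  have "(\<lambda>n. b (grid_last n c b)) \<longlonglongrightarrow> b ?G"
    using pos G1 grid_last_nonneg grid_last_le_1
    by (intro continuous_on_tendsto_compose[OF cont lim]) auto
  moreover have "(\<lambda>n. c * sqrt (grid_last n c b)) \<longlonglongrightarrow> c * sqrt ?G"
    by (intro tendsto_intros lim)
  moreover have "\<forall>\<^sub>F n in sequentially. b (grid_last n c b) \<le> c * sqrt (grid_last n c b)"
    using order_tendstoD(1)[OF lim pos] by eventually_elim (rule grid_last_below)
  ultimately show "b ?G \<le> c * sqrt ?G"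
    by (intro tendsto_le[OF sequentially_bot]) auto
  have "(\<lambda>n. grid_last n c b + 1 / 2 ^ n) \<longlonglongrightarrow> ?G + 0"
    by (intro tendsto_intros lim LIMSEQ_divide_realpow_zero) simp
  then have lim': "(\<lambda>n. grid_last n c b + 1 / 2 ^ n) \<longlonglongrightarrow> ?G"
    by simp
  have "(\<lambda>n. b (grid_last n c b + 1 / 2 ^ n)) \<longlonglongrightarrow> b ?G"
    using pos G1 grid_last_nonneg grid_last_next(1)[of c b, OF b1]
    by (intro continuous_on_tendsto_compose[OF cont lim']) (auto intro!: always_eventually add_nonneg_nonneg)
  moreover have "(\<lambda>n. c * sqrt (grid_last n c b + 1 / 2 ^ n)) \<longlonglongrightarrow> c * sqrt ?G"
    by (intro tendsto_intros lim')
  moreover have "\<forall>\<^sub>F n in sequentially. c * sqrt (grid_last n c b + 1 / 2 ^ n) \<le> b (grid_last n c b + 1 / 2 ^ n)"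
    using grid_last_next(2)[of c b, OF b1] by (intro always_eventually allI less_imp_le)
  ultimately show "c * sqrt ?G \<le> b ?G"
    by (intro tendsto_le[OF sequentially_bot]) auto
qed

text \<open>The boundary starts at 0 whatever the sign of \<open>c\<close>, so a path starting
  strictly below 0 stays below it for a short time. The lemma is meant for Brownian paths shifted
  down by \<open>v\<close>.\<close>

lemma crossing_lim_pos:
  assumes cont: "continuous_on {0..1} b" and "b 0 < 0"
  shows "crossing_lim c b > 0"
proof -
  have "continuous_on {0..1} (\<lambda>t. b t - c * sqrt t)"
    by (intro continuous_intros cont)
  then have "((\<lambda>t. b t - c * sqrt t) \<longlongrightarrow> b 0 - c * sqrt 0) (at 0 within {0..1})"
    unfolding continuous_on_def by (metis atLeastAtMost_iff order_refl zero_le_one)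
  then have "\<forall>\<^sub>F t in at 0 within {0..1}. b t - c * sqrt t < 0"
    by (rule order_tendstoD) (use assms in simp)
  then obtain d where d: "d > 0" "\<And>t. t \<in> {0..1} \<Longrightarrow> t \<noteq> 0 \<Longrightarrow> dist t 0 < d \<Longrightarrow> b t - c * sqrt t < 0"
    unfolding eventually_at by auto
  define t where "t = min (d / 2) (1 / 2)"
  have "0 < t" "t < 1" "t < d"
    using d by (auto simp: t_def)
  then show ?thesis
    using d(2)[of t] crossing_lim_ge[OF cont, of t c] by auto
qed

section \<open>The last crossing time of a continuous path\<close>

lemma last_crossing_bounds: "0 \<le> last_crossing B c \<omega>" "last_crossing B c \<omega> \<le> 1"
proof -
  let ?S = "{t \<in> {0<..1}. B t \<omega> = c * sqrt t}"
  have "0 \<le> Sup ?S \<and> Sup ?S \<le> 1" if ne: "?S \<noteq> {}"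
  proof -
    obtain t where t: "t \<in> ?S" using ne by blast
    have "bdd_above ?S" by (rule bdd_aboveI[of _ 1]) auto
    then have "t \<le> Sup ?S" using t by (intro cSup_upper)
    moreover have "Sup ?S \<le> 1" using ne by (intro cSup_least) auto
    ultimately show ?thesis using t by auto
  qed
  then show "0 \<le> last_crossing B c \<omega>" "last_crossing B c \<omega> \<le> 1"
    by (auto simp: last_crossing_def Let_def)
qed

lemma last_crossing_ge:
  assumes "t \<in> {0<..1}" "B t \<omega> = c * sqrt t"
  shows "t \<le> last_crossing B c \<omega>"
proof -
  have "bdd_above {t \<in> {0<..1}. B t \<omega> = c * sqrt t}" by (rule bdd_aboveI[of _ 1]) auto
  then show ?thesis
    using assms by (auto simp: last_crossing_def Let_def intro!: cSup_upper)
qed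

lemma last_crossing_eq:
  assumes cont: "continuous_on {0..1} (\<lambda>t. B t \<omega>)" and pos: "last_crossing B c \<omega> > 0"
  shows "B (last_crossing B c \<omega>) \<omega> = c * sqrt (last_crossing B c \<omega>)"
proof -
  let ?S = "{t \<in> {0<..1}. B t \<omega> = c * sqrt t}" and ?L = "last_crossing B c \<omega>"
  have ne: "?S \<noteq> {}" and L: "?L = Sup ?S"
    using pos by (auto simp: last_crossing_def Let_def split: if_splits)
  have bdd: "bdd_above ?S" by (rule bdd_aboveI[of _ 1]) auto
  \<comment> \<open>The time 0 is included because (0, 1] is not closed; the enlarged set is closed
    and therefore contains the supremum of \<open>?S\<close>.\<close>
  have "closed {t \<in> {0..1}. B t \<omega> - c * sqrt t = 0}"
    by (intro continuous_closed_preimage_constant continuous_intros cont)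
  moreover have "?S \<subseteq> {t \<in> {0..1}. B t \<omega> - c * sqrt t = 0}"
    by auto
  ultimately have "closure ?S \<subseteq> {t \<in> {0..1}. B t \<omega> - c * sqrt t = 0}"
    by (rule closure_minimal[rotated])
  moreover have "?L \<in> closure ?S"
    unfolding L by (rule closure_contains_Sup[OF ne bdd])
  ultimately show ?thesis by auto
qed

lemma above_after_last_crossing:
  assumes cont: "continuous_on {0..1} (\<lambda>t. B t \<omega>)" and B1: "B 1 \<omega> > c"
    and t: "last_crossing B c \<omega> < t" "t \<le> 1"
  shows "B t \<omega> > c * sqrt t"
proof (rule ccontr)
  assume neg: "\<not> ?thesis"
  have t0: "0 < t"
    using t last_crossing_bounds(1)[of B c \<omega>] by linarith
  have "continuous_on {t..1} (\<lambda>t. B t \<omega> - c * sqrt t)"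
    using t0 by (intro continuous_intros continuous_on_subset[OF cont]) auto
  then obtain u where "t \<le> u" "u \<le> 1" "B u \<omega> - c * sqrt u = 0"
    using IVT'[of "\<lambda>t. B t \<omega> - c * sqrt t" t 0 1] neg B1 t by auto
  then have "u \<le> last_crossing B c \<omega>"
    using t0 by (intro last_crossing_ge) auto
  then show False
    using t \<open>t \<le> u\<close> by linarith
qed

text \<open>At its last crossing the path is strictly below every raised boundary, so even a
  touching point is seen by the grids. Conversely, on \<open>{z..1}\<close> with \<open>z\<close>
  beyond the last crossing the path keeps a positive distance from the boundary by compactness, and
  a level raised by less than this distance is not crossed there.\<close>

lemma crossing_lim_tendsto_last_crossing:
  assumes cont: "continuous_on {0..1} (\<lambda>t. B t \<omega>)" and B1: "B 1 \<omega> > c"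
  shows "(\<lambda>m. crossing_lim (c + 1 / real (Suc m)) (\<lambda>t. B t \<omega>)) \<longlonglongrightarrow> last_crossing B c \<omega>"
    (is "?G \<longlonglongrightarrow> ?L")
proof (rule order_tendstoI)
  have L1: "?L < 1"
  proof (rule ccontr)
    assume "\<not> ?L < 1"
    then have "?L = 1" using last_crossing_bounds(2)[of B c \<omega>] by linarith
    then show False using last_crossing_eq[where B = B and \<omega> = \<omega> and c = c, OF cont] B1 by simp
  qed
  have "?L \<le> ?G m" for m
  proof (cases "?L > 0")
    case True
    then have "B ?L \<omega> < (c + 1 / real (Suc m)) * sqrt ?L"
      using last_crossing_eq[where B = B and \<omega> = \<omega> and c = c, OF cont] by (simp add: field_simps add_pos_pos)
    then show ?thesis
      using True L1 by (intro crossing_lim_ge[OF cont])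
  next
    case False
    then show ?thesis using crossing_lim_nonneg[of "c + 1 / real (Suc m)" "\<lambda>t. B t \<omega>"] by linarith
  qed
  then show "\<forall>\<^sub>F m in sequentially. y < ?G m" if "y < ?L" for y
    by (intro always_eventually allI less_le_trans[OF that])
  fix y assume y: "?L < y"
  \<comment> \<open>The minimum with 1 keeps \<open>{z..1}\<close> nonempty; \<open>z\<close> still
    lies strictly between \<open>?L\<close> and \<open>y\<close>, as \<open>?L < 1\<close>.\<close>
  define z where "z = min ((?L + y) / 2) 1"
  have z: "?L < z" "z < y" "z \<le> 1" "0 < z"
    using y L1 last_crossing_bounds[of B c \<omega>] by (auto simp: z_def min_def)
  have "continuous_on {z..1} (\<lambda>t. B t \<omega> - c * sqrt t)"
    using z by (intro continuous_intros continuous_on_subset[OF cont]) auto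
  then obtain u where u: "u \<in> {z..1}" "\<And>t. t \<in> {z..1} \<Longrightarrow> B u \<omega> - c * sqrt u \<le> B t \<omega> - c * sqrt t"
    using continuous_attains_inf[of "{z..1}" "\<lambda>t. B t \<omega> - c * sqrt t"] z by auto
  have "B u \<omega> - c * sqrt u > 0"
    using above_after_last_crossing[where B = B and \<omega> = \<omega>, OF cont B1, of u] u z by auto
  with LIMSEQ_inverse_real_of_nat
  have "\<forall>\<^sub>F m in sequentially. inverse (real (Suc m)) < B u \<omega> - c * sqrt u"
    by (rule order_tendstoD)
  then show "\<forall>\<^sub>F m in sequentially. ?G m < y"
  proof eventually_elim
    case (elim m)
    have "grid_last n (c + 1 / real (Suc m)) (\<lambda>t. B t \<omega>) \<le> z" for n
    proof (rule ccontr)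
      let ?g = "grid_last n (c + 1 / real (Suc m)) (\<lambda>t. B t \<omega>)"
      assume neg: "\<not> ?g \<le> z"
      then have "B ?g \<omega> \<le> (c + 1 / real (Suc m)) * sqrt ?g"
        using z by (intro grid_last_below) auto
      moreover have "B u \<omega> - c * sqrt u \<le> B ?g \<omega> - c * sqrt ?g"
        using neg grid_last_le_1 by (intro u) auto
      moreover have "1 / real (Suc m) * sqrt ?g \<le> 1 / real (Suc m) * 1"
        using grid_last_le_1 by (intro mult_left_mono) auto
      ultimately show False
        using elim by (simp add: algebra_simps inverse_eq_divide)
    qed
    then have "?G m \<le> z"
      by (intro crossing_lim_le)
    then show ?case using z by linarith
  qed
qed

text \<open>
  The grid point \<open>grid_last n c b\<close> sees the path slightly below the level \<open>c * sqrt t\<close>. The lower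
  bound imposed here keeps this undershoot, and with it the exponential weight, bounded.
\<close>

definition grid_crossing :: "nat \<Rightarrow> real \<Rightarrow> (real \<Rightarrow> real) \<Rightarrow> bool" where
  "grid_crossing n c b \<longleftrightarrow> c < b 1 \<and> 0 < grid_last n c b
    \<and> (c - 1) * sqrt (grid_last n c b) \<le> b (grid_last n c b)"

section \<open>The exponential weight at the last grid crossing\<close>

text \<open>In terms of \<open>y = v / sqrt g\<close> the exponent is at most
  \<open>- a * y - y\<^sup>2 / 2\<close>, whose maximum over all \<open>y\<close> is
  \<open>a\<^sup>2 / 2\<close>. The bound does not involve \<open>g\<close>, so it serves for
  dominated convergence.\<close>

lemma exp_weight_le:
  fixes v g x a :: real
  assumes "v \<ge> 0" "g > 0" "a * sqrt g \<le> x"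
  shows "exp (- v * x / g - v\<^sup>2 / (2 * g)) \<le> exp (a\<^sup>2 / 2)"
proof -
  let ?y = "v / sqrt g"
  have "- v * x / g \<le> - v * (a * sqrt g) / g"
    using assms by (intro divide_right_mono mult_left_mono_neg) auto
  also have "\<dots> = - (a * ?y)"
    using assms by (simp add: real_div_sqrt field_simps)
  finally have "- v * x / g \<le> - (a * ?y)" .
  moreover have "v\<^sup>2 / (2 * g) = ?y\<^sup>2 / 2"
    using assms by (simp add: power_divide)
  moreover have "- (a * y) - y\<^sup>2 / 2 \<le> a\<^sup>2 / 2" for y :: real
    using zero_le_power2[of "y + a"] by (simp add: power2_eq_square algebra_simps)
  from this[of ?y] have "- (a * ?y) - ?y\<^sup>2 / 2 \<le> a\<^sup>2 / 2" .
  ultimately have "- v * x / g - v\<^sup>2 / (2 * g) \<le> a\<^sup>2 / 2" by linarith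
  then show ?thesis by simp
qed

lemma grid_value_tendsto:
  assumes cont: "continuous_on {0..1} b" and b1: "b 1 > c" and pos: "crossing_lim c b > 0"
  shows "(\<lambda>n. b (grid_last n c b)) \<longlonglongrightarrow> c * sqrt (crossing_lim c b)"
proof -
  have "(\<lambda>n. b (grid_last n c b)) \<longlonglongrightarrow> b (crossing_lim c b)"
    using pos grid_last_nonneg grid_last_le_1 crossing_lim_le[OF grid_last_le_1]
    by (intro continuous_on_tendsto_compose[OF cont grid_last_LIMSEQ]) auto
  then show ?thesis
    by (simp add: crossing_lim_eq[OF assms])
qed

text \<open>In the limit the path sits on the boundary itself, strictly above the lower bound with
  \<open>c - 1\<close>, so the restriction on the undershoot holds on all fine grids.\<close>

lemma eventually_grid_crossing:
  assumes cont: "continuous_on {0..1} b" and b1: "b 1 > c" and pos: "crossing_lim c b > 0"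
  shows "\<forall>\<^sub>F n in sequentially. grid_crossing n c b"
proof -
  have "(\<lambda>n. b (grid_last n c b) - (c - 1) * sqrt (grid_last n c b))
      \<longlonglongrightarrow> c * sqrt (crossing_lim c b) - (c - 1) * sqrt (crossing_lim c b)"
    by (intro tendsto_intros grid_value_tendsto[OF assms] grid_last_LIMSEQ)
  then have "\<forall>\<^sub>F n in sequentially. 0 < b (grid_last n c b) - (c - 1) * sqrt (grid_last n c b)"
    by (rule order_tendstoD) (use pos in \<open>simp add: algebra_simps\<close>)
  moreover have "\<forall>\<^sub>F n in sequentially. 0 < grid_last n c b"
    using grid_last_LIMSEQ pos by (rule order_tendstoD)
  ultimately show ?thesis
    by eventually_elim (use b1 in \<open>simp add: grid_crossing_def\<close>)
qed

lemma grid_weight_tendsto: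
  assumes cont: "continuous_on {0..1} b"
  shows "(\<lambda>n. if grid_crossing n c b
      then exp (- v * b (grid_last n c b) / grid_last n c b - v\<^sup>2 / (2 * grid_last n c b)) else 0)
    \<longlonglongrightarrow> (if c < b 1 \<and> 0 < crossing_lim c b
      then exp (- v * c / sqrt (crossing_lim c b) - v\<^sup>2 / (2 * crossing_lim c b)) else 0)"
proof (cases "c < b 1 \<and> 0 < crossing_lim c b")
  case True
  then have "(\<lambda>n. exp (- v * b (grid_last n c b) / grid_last n c b - v\<^sup>2 / (2 * grid_last n c b)))
    \<longlonglongrightarrow> exp (- v * (c * sqrt (crossing_lim c b)) / crossing_lim c b - v\<^sup>2 / (2 * crossing_lim c b))"
    by (intro tendsto_intros grid_value_tendsto cont grid_last_LIMSEQ) auto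
  also have "- v * (c * sqrt (crossing_lim c b)) / crossing_lim c b = - v * c / sqrt (crossing_lim c b)"
    using True by (simp add: real_div_sqrt field_simps)
  finally have "(\<lambda>n. exp (- v * b (grid_last n c b) / grid_last n c b - v\<^sup>2 / (2 * grid_last n c b)))
    \<longlonglongrightarrow> exp (- v * c / sqrt (crossing_lim c b) - v\<^sup>2 / (2 * crossing_lim c b))" .
  moreover have "\<forall>\<^sub>F n in sequentially. exp (- v * b (grid_last n c b) / grid_last n c b - v\<^sup>2 / (2 * grid_last n c b)) =
      (if grid_crossing n c b
       then exp (- v * b (grid_last n c b) / grid_last n c b - v\<^sup>2 / (2 * grid_last n c b)) else 0)"
    using eventually_grid_crossing[OF cont, of c] True by (auto elim: eventually_mono)
  ultimately show ?thesis
    using True by (simp add: Lim_transform_eventually)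
next
  case False
  \<comment> \<open>Grid values never exceed their limit: if the limit is 0, every grid value is 0
    and all weights vanish.\<close>
  have "\<not> grid_crossing n c b" for n
    using False grid_last_le_crossing_lim[of n c b] by (auto simp: grid_crossing_def)
  then show ?thesis using False by auto
qed

text \<open>
  The condition \<open>grid_last_at n c k h\<close> says that \<open>k / 2 ^ n\<close> is the last grid crossing, in terms
  of the path from that time on: \<open>h i\<close> stands for its value at time \<open>(k + i) / 2 ^ n\<close>.
\<close>

definition grid_last_at :: "nat \<Rightarrow> real \<Rightarrow> nat \<Rightarrow> (nat \<Rightarrow> real) \<Rightarrow> bool" where
  "grid_last_at n c k h \<longleftrightarrow> h 0 \<le> c * sqrt (real k / 2 ^ n) \<and> (c - 1) * sqrt (real k / 2 ^ n) \<le> h 0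
    \<and> (\<forall>i\<in>{..2 ^ n - k}. 0 < i \<longrightarrow> c * sqrt (real (k + i) / 2 ^ n) < h i)"

text \<open>The window ends at time 1, so the strict inequality at its last index is
  \<open>c < b 1\<close>. The event thus depends only on the path from time \<open>k / 2 ^ n\<close>
  on, as \<open>nn_integral_shifted_start\<close> requires.\<close>

lemma grid_last_at_iff:
  assumes k: "1 \<le> k" "k < 2 ^ n"
  shows "grid_last_at n c k (\<lambda>i\<in>{..2 ^ n - k}. b (real (k + i) / 2 ^ n))
    \<longleftrightarrow> grid_crossing n c b \<and> grid_last n c b = real k / 2 ^ n"
proof
  assume *: "grid_last_at n c k (\<lambda>i\<in>{..2 ^ n - k}. b (real (k + i) / 2 ^ n))"
  then have le: "b (real k / 2 ^ n) \<le> c * sqrt (real k / 2 ^ n)"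
    and ge: "(c - 1) * sqrt (real k / 2 ^ n) \<le> b (real k / 2 ^ n)"
    by (auto simp: grid_last_at_def)
  have gt: "c * sqrt (real j / 2 ^ n) < b (real j / 2 ^ n)" if "k < j" "j \<le> 2 ^ n" for j
    using * that unfolding grid_last_at_def by (auto dest!: bspec[of _ _ "j - k"])
  have "c < b 1"
    using gt[of "2 ^ n"] k by simp
  obtain j where j: "j \<le> 2 ^ n" "grid_last n c b = real j / 2 ^ n"
    "j = 0 \<or> b (real j / 2 ^ n) \<le> c * sqrt (real j / 2 ^ n)"
    by (rule grid_last_cases)
  have "real k / 2 ^ n \<le> real j / 2 ^ n"
    unfolding j(2)[symmetric] using k le by (intro grid_last_ge) auto
  then have "k \<le> j" by (simp add: divide_le_cancel)
  moreover have "\<not> k < j"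
    using gt[of j] j k by force
  ultimately have "grid_last n c b = real k / 2 ^ n"
    using j by simp
  then show "grid_crossing n c b \<and> grid_last n c b = real k / 2 ^ n"
    using \<open>c < b 1\<close> ge k by (simp add: grid_crossing_def)
next
  assume *: "grid_crossing n c b \<and> grid_last n c b = real k / 2 ^ n"
  have "c * sqrt (real (k + i) / 2 ^ n) < b (real (k + i) / 2 ^ n)" if "0 < i" "k + i \<le> 2 ^ n" for i
  proof (rule ccontr)
    assume "\<not> ?thesis"
    then have "real (k + i) / 2 ^ n \<le> grid_last n c b"
      using that by (intro grid_last_ge) auto
    then show False using * that by (simp add: divide_le_cancel)
  qed
  then show "grid_last_at n c k (\<lambda>i\<in>{..2 ^ n - k}. b (real (k + i) / 2 ^ n))"
    using * k grid_last_below[of n c b] by (auto simp: grid_last_at_def grid_crossing_def)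
qed

text \<open>Exactly one summand survives on \<open>grid_crossing\<close>: index 0 is excluded by
  positivity and index \<open>2 ^ n\<close> by \<open>c < b 1\<close>. The random time inside
  \<open>F\<close> is thereby traded for deterministic ones.\<close>

lemma grid_crossing_decomposition:
  fixes F :: "real \<Rightarrow> ennreal"
  shows "(if grid_crossing n c b then F (grid_last n c b) else 0) =
    (\<Sum>k\<in>{1..<2 ^ n}. (if grid_last_at n c k (\<lambda>i\<in>{..2 ^ n - k}. b (real (k + i) / 2 ^ n)) then 1 else 0)
       * F (real k / 2 ^ n))"
proof (cases "grid_crossing n c b")
  case True
  then obtain k where k: "k \<le> 2 ^ n" "grid_last n c b = real k / 2 ^ n"
    by (meson grid_last_cases)
  have "0 < real k / 2 ^ n"
    using True k by (simp add: grid_crossing_def)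
  then have "k \<noteq> 0"
    by (auto simp: zero_less_divide_iff)
  moreover have "k \<noteq> 2 ^ n"
    using True k grid_last_below[of n c b] by (auto simp: grid_crossing_def)
  ultimately have k': "k \<in> {1..<2 ^ n}"
    using k by auto
  have "(\<Sum>j\<in>{1..<2 ^ n}. (if grid_last_at n c j (\<lambda>i\<in>{..2 ^ n - j}. b (real (j + i) / 2 ^ n)) then 1 else 0)
       * F (real j / 2 ^ n)) = (\<Sum>j\<in>{1..<2 ^ n}. if k = j then F (real j / 2 ^ n) else 0)"
  proof (rule sum.cong)
    fix j :: nat assume "j \<in> {1..<2 ^ n}"
    then have "grid_last_at n c j (\<lambda>i\<in>{..2 ^ n - j}. b (real (j + i) / 2 ^ n)) \<longleftrightarrow> k = j"
      using grid_last_at_iff[of j n c b] True k by auto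
    then show "(if grid_last_at n c j (\<lambda>i\<in>{..2 ^ n - j}. b (real (j + i) / 2 ^ n)) then 1 else 0)
       * F (real j / 2 ^ n) = (if k = j then F (real j / 2 ^ n) else 0)"
      by simp
  qed simp
  also have "\<dots> = F (grid_last n c b)"
    using k k' by simp
  finally show ?thesis using True by simp
next
  case False
  then have "(\<Sum>j\<in>{1..<2 ^ n}. (if grid_last_at n c j (\<lambda>i\<in>{..2 ^ n - j}. b (real (j + i) / 2 ^ n)) then 1 else 0)
       * F (real j / 2 ^ n)) = 0"
    by (intro sum.neutral ballI) (simp only: grid_last_at_iff atLeastLessThan_iff, simp)
  then show ?thesis using False by simp
qed

section \<open>The last crossing as seen from a shifted starting point\<close>

context standard_brownian_motion
begin

text \<open>
  Weighting by \<open>exp (- v * B s / s - v\<^sup>2 / (2 * s))\<close> shifts the centred normal density of \<open>B s\<close>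
  by \<open>- v\<close> and leaves the increments after time \<open>s = \<tau> 0\<close> untouched: from time \<open>s\<close> on, \<open>B\<close> then
  behaves like a Brownian motion started at \<open>- v\<close>.
\<close>

lemma nn_integral_shifted_start:
  fixes \<tau> :: "nat \<Rightarrow> real" and m :: nat and v :: real
  assumes \<tau>0: "\<tau> 0 > 0" and \<tau>mono: "\<And>i. i < m \<Longrightarrow> \<tau> i \<le> \<tau> (Suc i)"
    and f[measurable]: "f \<in> borel_measurable (PiM {..m} (\<lambda>_. borel :: real measure))"
  shows "(\<integral>\<^sup>+\<omega>. f (\<lambda>i\<in>{..m}. B (\<tau> i) \<omega>) * ennreal (exp (- v * B (\<tau> 0) \<omega> / \<tau> 0 - v\<^sup>2 / (2 * \<tau> 0))) \<partial>M)
    = (\<integral>\<^sup>+\<omega>. f (\<lambda>i\<in>{..m}. B (\<tau> i) \<omega> - v) \<partial>M)"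
proof -
  \<comment> \<open>Time 0 is put in front of the grid, so that the first increment is the starting
    value \<open>B (\<tau> 0)\<close>, up to the null set where \<open>B 0\<close> is not 0.\<close>
  define \<sigma> where "\<sigma> i = (case i of 0 \<Rightarrow> 0 | Suc j \<Rightarrow> \<tau> j)" for i
  define D where "D i \<omega> = B (\<sigma> (Suc i)) \<omega> - B (\<sigma> i) \<omega>" for i \<omega>
  define X where "X = D 0"
  \<comment> \<open>Independence of blocks of increments is stated for restrictions to index sets;
    \<open>X'\<close> is \<open>X\<close> as a function on a one-point set.\<close>
  define X' where "X' \<omega> = restrict (\<lambda>i. D i \<omega>) {0}" for \<omega>
  define Y where "Y \<omega> = restrict (\<lambda>i. D i \<omega>) {0<..m}" for \<omega>
  \<comment> \<open>\<open>T\<close> rebuilds the path values from the starting value and the later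
    increments. Lowering \<open>x\<close> by \<open>v\<close> lowers all of them by
    \<open>v\<close>.\<close>
  define T where "T x y = (\<lambda>i\<in>{..m}. x + (\<Sum>j\<in>{0<..i}. y j))" for x :: real and y :: "nat \<Rightarrow> real"
  let ?N = "PiM {0<..m} (\<lambda>_. borel :: real measure)"
  let ?P = "PiM {0} (\<lambda>_. borel :: real measure)"
  let ?\<phi> = "normal_density 0 (sqrt (\<tau> 0))"
  have "indep_vars (\<lambda>_. borel) D {..<Suc m}"
    unfolding D_def using \<tau>0 \<tau>mono
    by (intro indep_increments) (auto simp: \<sigma>_def split: nat.split)
  then have "indep_var ?P X' ?N Y"
    unfolding X'_def[abs_def] Y_def[abs_def] by (rule indep_var_restrict) auto
  then have [measurable]: "X' \<in> measurable M ?P" "Y \<in> measurable M ?N"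
    and joint: "distr M ?P X' \<Otimes>\<^sub>M distr M ?N Y = distr M (?P \<Otimes>\<^sub>M ?N) (\<lambda>\<omega>. (X' \<omega>, Y \<omega>))"
    unfolding indep_var_distribution_eq by auto
  have X': "X' \<omega> 0 = X \<omega>" for \<omega>
    by (simp add: X'_def X_def)
  have [measurable]: "X \<in> borel_measurable M"
    unfolding X'[symmetric] by measurable
  have X: "distr M lborel X = density lborel (\<lambda>x. ennreal (?\<phi> x))"
    using normal_increments[of 0 "\<tau> 0"] \<tau>0 by (simp add: distributed_def X_def D_def[abs_def] \<sigma>_def)
  interpret Y: prob_space "distr M ?N Y"
    by (rule prob_space_distr) simp
  have split: "(\<integral>\<^sup>+\<omega>. k (X \<omega>) (Y \<omega>) \<partial>M) = (\<integral>\<^sup>+x. ennreal (?\<phi> x) * (\<integral>\<^sup>+y. k x y \<partial>distr M ?N Y) \<partial>lborel)"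
    if k[measurable]: "(\<lambda>(x, y). k x y) \<in> borel_measurable (borel \<Otimes>\<^sub>M ?N)" for k
  proof -
    have "(\<integral>\<^sup>+\<omega>. k (X \<omega>) (Y \<omega>) \<partial>M)
        = (\<integral>\<^sup>+z. (\<lambda>(h, y). k (h 0) y) z \<partial>distr M (?P \<Otimes>\<^sub>M ?N) (\<lambda>\<omega>. (X' \<omega>, Y \<omega>)))"
      by (subst nn_integral_distr) (auto simp: X')
    also have "\<dots> = (\<integral>\<^sup>+h. \<integral>\<^sup>+y. k (h 0) y \<partial>distr M ?N Y \<partial>distr M ?P X')"
      unfolding joint[symmetric] by (subst Y.nn_integral_fst[symmetric]) auto
    also have "\<dots> = (\<integral>\<^sup>+\<omega>. \<integral>\<^sup>+y. k (X \<omega>) y \<partial>distr M ?N Y \<partial>M)"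
      by (subst nn_integral_distr) (auto simp: X')
    also have "\<dots> = (\<integral>\<^sup>+x. \<integral>\<^sup>+y. k x y \<partial>distr M ?N Y \<partial>distr M lborel X)"
      by (subst nn_integral_distr) auto
    also have "\<dots> = (\<integral>\<^sup>+x. ennreal (?\<phi> x) * (\<integral>\<^sup>+y. k x y \<partial>distr M ?N Y) \<partial>lborel)"
      unfolding X by (subst nn_integral_density) auto
    finally show ?thesis .
  qed
  have T_meas[measurable]: "(\<lambda>(x, y). T x y) \<in> measurable (borel \<Otimes>\<^sub>M ?N) (PiM {..m} (\<lambda>_. borel))"
    unfolding T_def split_beta' by measurable
  \<comment> \<open>The weight supplies exactly the terms that complete the square in the Gaussian
    exponent.\<close>
  have shift: "?\<phi> x * exp (- v * x / \<tau> 0 - v\<^sup>2 / (2 * \<tau> 0)) = ?\<phi> (x + v)" for x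
    using \<tau>0 by (simp add: normal_density_def power2_eq_square field_simps flip: exp_add)
  have "AE \<omega> in M. \<forall>i\<le>m. T (X \<omega>) (Y \<omega>) i = B (\<tau> i) \<omega>"
    using start_zero
  proof eventually_elim
    case (elim \<omega>)
    show ?case
    proof (intro allI impI)
      fix i assume "i \<le> m"
      have "T (X \<omega>) (Y \<omega>) i = D 0 \<omega> + (\<Sum>j\<in>{0<..i}. D j \<omega>)"
        using \<open>i \<le> m\<close> by (simp add: T_def X_def Y_def)
      also have "\<dots> = (\<Sum>j<Suc i. B (\<sigma> (Suc j)) \<omega> - B (\<sigma> j) \<omega>)"
        by (simp add: D_def lessThan_Suc_atMost atMost_atLeast0 sum.head)
      also have "\<dots> = B (\<sigma> (Suc i)) \<omega> - B (\<sigma> 0) \<omega>"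
        by (rule sum_lessThan_telescope)
      also have "\<dots> = B (\<tau> i) \<omega>"
        using elim by (simp add: \<sigma>_def)
      finally show "T (X \<omega>) (Y \<omega>) i = B (\<tau> i) \<omega>" .
    qed
  qed
  then have TB: "AE \<omega> in M. T (X \<omega>) (Y \<omega>) = (\<lambda>i\<in>{..m}. B (\<tau> i) \<omega>) \<and> X \<omega> = B (\<tau> 0) \<omega>
      \<and> T (X \<omega> - v) (Y \<omega>) = (\<lambda>i\<in>{..m}. B (\<tau> i) \<omega> - v)"
  proof eventually_elim
    case (elim \<omega>)
    have "T (X \<omega>) (Y \<omega>) 0 = X \<omega>" by (simp add: T_def)
    moreover have "T x y i = undefined" if "\<not> i \<le> m" for x y i
      using that by (simp add: T_def)
    moreover have "T (X \<omega> - v) (Y \<omega>) i = T (X \<omega>) (Y \<omega>) i - v" if "i \<le> m" for i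
      using that by (simp add: T_def)
    ultimately show ?case using elim by (auto simp: fun_eq_iff)
  qed
  have "(\<integral>\<^sup>+\<omega>. f (\<lambda>i\<in>{..m}. B (\<tau> i) \<omega>) * ennreal (exp (- v * B (\<tau> 0) \<omega> / \<tau> 0 - v\<^sup>2 / (2 * \<tau> 0))) \<partial>M)
      = (\<integral>\<^sup>+\<omega>. f (T (X \<omega>) (Y \<omega>)) * ennreal (exp (- v * X \<omega> / \<tau> 0 - v\<^sup>2 / (2 * \<tau> 0))) \<partial>M)"
    by (intro nn_integral_cong_AE eventually_mono[OF TB]) auto
  also have "\<dots> = (\<integral>\<^sup>+x. ennreal (?\<phi> x) * (\<integral>\<^sup>+y. f (T x y) * ennreal (exp (- v * x / \<tau> 0 - v\<^sup>2 / (2 * \<tau> 0))) \<partial>distr M ?N Y) \<partial>lborel)"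
    by (intro split) measurable
  also have "\<dots> = (\<integral>\<^sup>+x. ennreal (?\<phi> (x + v)) * (\<integral>\<^sup>+y. f (T x y) \<partial>distr M ?N Y) \<partial>lborel)"
    by (intro nn_integral_cong, subst nn_integral_multc)
       (auto simp: mult_ac ennreal_mult simp flip: shift)
  also have "\<dots> = (\<integral>\<^sup>+x. ennreal (?\<phi> x) * (\<integral>\<^sup>+y. f (T (x - v) y) \<partial>distr M ?N Y) \<partial>lborel)"
    by (subst nn_integral_real_affine[where c = 1 and t = "- v"]) auto
  also have "\<dots> = (\<integral>\<^sup>+\<omega>. f (T (X \<omega> - v) (Y \<omega>)) \<partial>M)"
    by (intro split[symmetric]) measurable
  also have "\<dots> = (\<integral>\<^sup>+\<omega>. f (\<lambda>i\<in>{..m}. B (\<tau> i) \<omega> - v) \<partial>M)"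
    by (intro nn_integral_cong_AE eventually_mono[OF TB]) auto
  finally show ?thesis .
qed

end

lemma measurable_grid_last_at[measurable]:
  "Measurable.pred (PiM {..2 ^ n - k} (\<lambda>_. borel :: real measure)) (grid_last_at n c k)"
  unfolding grid_last_at_def
  by (intro pred_intros_logic pred_intros_finite) (measurable, auto)

text \<open>With \<open>y = v / sqrt (g m)\<close>, half of the term \<open>y\<^sup>2 / 2\<close>
  absorbs the linear term at the cost of \<open>A\<^sup>2\<close>, and the rest decays:
  \<open>exp (- (y\<^sup>2 / 4))\<close> is at most \<open>4 / y\<^sup>2\<close>. This covers paths
  whose crossing times shrink to 0.\<close>

lemma exp_weight_vanishes:
  fixes v c :: real and g a :: "nat \<Rightarrow> real"
  assumes v: "v > 0" and g: "g \<longlonglongrightarrow> 0" "\<And>m. g m \<ge> 0" and a: "\<And>m. \<bar>a m\<bar> \<le> A"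
  shows "(\<lambda>m. if 0 < g m then exp (- v * a m / sqrt (g m) - v\<^sup>2 / (2 * g m)) else 0) \<longlonglongrightarrow> 0"
proof (rule Lim_null_comparison)
  show "(\<lambda>m. exp (A\<^sup>2) * (4 * g m / v\<^sup>2)) \<longlonglongrightarrow> 0"
    using v by (auto intro!: tendsto_eq_intros g)
  show "\<forall>\<^sub>F m in sequentially. norm (if 0 < g m then exp (- v * a m / sqrt (g m) - v\<^sup>2 / (2 * g m)) else 0)
      \<le> exp (A\<^sup>2) * (4 * g m / v\<^sup>2)"
  proof (intro always_eventually allI)
    fix m
    show "norm (if 0 < g m then exp (- v * a m / sqrt (g m) - v\<^sup>2 / (2 * g m)) else 0) \<le> exp (A\<^sup>2) * (4 * g m / v\<^sup>2)"
    proof (cases "0 < g m")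
      case True
      define y where "y = v / sqrt (g m)"
      have y2: "y\<^sup>2 = v\<^sup>2 / g m"
        using True by (simp add: y_def power_divide)
      have "0 \<le> (a m + y / 2)\<^sup>2" by simp
      moreover have "(a m)\<^sup>2 \<le> A\<^sup>2"
        using a[of m] by (simp add: abs_le_square_iff[symmetric])
      ultimately have "- (a m * y) - y\<^sup>2 / 2 \<le> A\<^sup>2 - y\<^sup>2 / 4"
        by (simp add: power2_eq_square algebra_simps)
      then have "exp (- (a m * y) - y\<^sup>2 / 2) \<le> exp (A\<^sup>2) * exp (- (y\<^sup>2 / 4))"
        by (simp flip: exp_add)
      also have "exp (- (y\<^sup>2 / 4)) \<le> 1 / (y\<^sup>2 / 4)"
      proof -
        have "y\<^sup>2 / 4 \<le> exp (y\<^sup>2 / 4)"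
          using exp_ge_add_one_self[of "y\<^sup>2 / 4"] by linarith
        moreover have "0 < y\<^sup>2 / 4"
          using v True by (simp add: y_def)
        ultimately show ?thesis
          by (simp only: exp_minus inverse_eq_divide) (intro divide_left_mono, auto)
      qed
      also have "1 / (y\<^sup>2 / 4) = 4 * g m / v\<^sup>2"
        by (simp add: y2)
      finally have "exp (- (a m * y) - y\<^sup>2 / 2) \<le> exp (A\<^sup>2) * (4 * g m / v\<^sup>2)"
        by simp
      moreover have "- v * a m / sqrt (g m) - v\<^sup>2 / (2 * g m) = - (a m * y) - y\<^sup>2 / 2"
        unfolding y2 by (simp add: y_def mult_ac)
      ultimately show ?thesis
        using True by simp
    next
      case False
      then show ?thesis using g(2)[of m] by simp
    qed
  qed
qed

section \<open>Mesh tending to 0 at a fixed level\<close>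

context standard_brownian_motion
begin

lemma measurable_B[measurable]: "0 \<le> t \<Longrightarrow> B t \<in> borel_measurable M"
  by (rule random_variable_B)

lemma AE_continuous_01: "AE \<omega> in M. continuous_on {0..1} (\<lambda>t. B t \<omega>)"
  using continuous_paths by eventually_elim (auto intro: continuous_on_subset)

text \<open>Only countably many times enter, so measurability holds for \<open>M\<close> itself,
  whereas \<open>last_crossing\<close> may need the completion.\<close>

lemma measurable_crossing_lim[measurable]: "(\<lambda>\<omega>. crossing_lim c (\<lambda>t. B t \<omega>)) \<in> borel_measurable M"
  unfolding crossing_lim_def grid_last_def by measurable

lemma measurable_grid_weight:
  assumes "\<And>k. k < 2 ^ n \<Longrightarrow> F (real k / 2 ^ n) \<in> borel_measurable M"
  shows "(\<lambda>\<omega>. if grid_crossing n c (\<lambda>t. B t \<omega> - v) then F (grid_last n c (\<lambda>t. B t \<omega> - v)) \<omega> else (0::ennreal))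
    \<in> borel_measurable M"
proof -
  have [measurable]: "(\<lambda>\<omega>. \<lambda>i\<in>{..2 ^ n - k}. B (real (k + i) / 2 ^ n) \<omega> - v)
      \<in> measurable M (PiM {..2 ^ n - k} (\<lambda>_. borel))" for k
    by measurable
  show ?thesis
    unfolding grid_crossing_decomposition[where F = "\<lambda>t. F t _"]
    using assms by (intro borel_measurable_sum borel_measurable_times_ennreal) (measurable, auto)
qed

text \<open>On the event that the last grid crossing is \<open>k / 2 ^ n\<close>, the weight
  involves only this fixed time. The shift is applied summand by summand and the sum is reassembled
  for the path started at \<open>- v\<close>.\<close>

lemma nn_integral_grid_weight:
  fixes c v :: real
  shows "(\<integral>\<^sup>+\<omega>. (if grid_crossing n c (\<lambda>t. B t \<omega>)
      then ennreal (exp (- v * B (grid_last n c (\<lambda>t. B t \<omega>)) \<omega> / grid_last n c (\<lambda>t. B t \<omega>)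
        - v\<^sup>2 / (2 * grid_last n c (\<lambda>t. B t \<omega>)))) else 0) \<partial>M)
    = (\<integral>\<^sup>+\<omega>. (if grid_crossing n c (\<lambda>t. B t \<omega> - v) then 1 else 0) \<partial>M)"
proof -
  define P where "P k h = (if grid_last_at n c k h then 1 else 0 :: ennreal)" for k h
  have [measurable]: "P k \<in> borel_measurable (PiM {..2 ^ n - k} (\<lambda>_. borel))" for k
    unfolding P_def by measurable
  have [measurable]: "(\<lambda>\<omega>. \<lambda>i\<in>{..2 ^ n - k}. B (real (k + i) / 2 ^ n) \<omega>)
      \<in> measurable M (PiM {..2 ^ n - k} (\<lambda>_. borel))"
    "(\<lambda>\<omega>. \<lambda>i\<in>{..2 ^ n - k}. B (real (k + i) / 2 ^ n) \<omega> - v)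
      \<in> measurable M (PiM {..2 ^ n - k} (\<lambda>_. borel))" for k
    by measurable
  have "(\<integral>\<^sup>+\<omega>. (if grid_crossing n c (\<lambda>t. B t \<omega>)
      then ennreal (exp (- v * B (grid_last n c (\<lambda>t. B t \<omega>)) \<omega> / grid_last n c (\<lambda>t. B t \<omega>)
        - v\<^sup>2 / (2 * grid_last n c (\<lambda>t. B t \<omega>)))) else 0) \<partial>M)
    = (\<integral>\<^sup>+\<omega>. (\<Sum>k\<in>{1..<2 ^ n}. P k (\<lambda>i\<in>{..2 ^ n - k}. B (real (k + i) / 2 ^ n) \<omega>)
        * ennreal (exp (- v * B (real k / 2 ^ n) \<omega> / (real k / 2 ^ n) - v\<^sup>2 / (2 * (real k / 2 ^ n))))) \<partial>M)"
    unfolding P_def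
    by (rule nn_integral_cong)
      (rule grid_crossing_decomposition[where b = "\<lambda>t. B t _" and
        F = "\<lambda>t. ennreal (exp (- v * B t _ / t - v\<^sup>2 / (2 * t)))"])
  also have "\<dots> = (\<Sum>k\<in>{1..<2 ^ n}. \<integral>\<^sup>+\<omega>. P k (\<lambda>i\<in>{..2 ^ n - k}. B (real (k + i) / 2 ^ n) \<omega>)
        * ennreal (exp (- v * B (real k / 2 ^ n) \<omega> / (real k / 2 ^ n) - v\<^sup>2 / (2 * (real k / 2 ^ n)))) \<partial>M)"
    by (rule nn_integral_sum) measurable
  also have "\<dots> = (\<Sum>k\<in>{1..<2 ^ n}. \<integral>\<^sup>+\<omega>. P k (\<lambda>i\<in>{..2 ^ n - k}. B (real (k + i) / 2 ^ n) \<omega> - v) \<partial>M)"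
  proof (rule sum.cong)
    fix k :: nat assume "k \<in> {1..<2 ^ n}"
    then show "(\<integral>\<^sup>+\<omega>. P k (\<lambda>i\<in>{..2 ^ n - k}. B (real (k + i) / 2 ^ n) \<omega>)
        * ennreal (exp (- v * B (real k / 2 ^ n) \<omega> / (real k / 2 ^ n) - v\<^sup>2 / (2 * (real k / 2 ^ n)))) \<partial>M)
      = (\<integral>\<^sup>+\<omega>. P k (\<lambda>i\<in>{..2 ^ n - k}. B (real (k + i) / 2 ^ n) \<omega> - v) \<partial>M)"
      using nn_integral_shifted_start[of "\<lambda>i. real (k + i) / 2 ^ n" "2 ^ n - k" "P k" v]
      by (simp add: divide_right_mono)
  qed simp
  also have "\<dots> = (\<integral>\<^sup>+\<omega>. (\<Sum>k\<in>{1..<2 ^ n}. P k (\<lambda>i\<in>{..2 ^ n - k}. B (real (k + i) / 2 ^ n) \<omega> - v) * 1) \<partial>M)"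
    unfolding mult_1_right by (rule nn_integral_sum[symmetric]) measurable
  also have "\<dots> = (\<integral>\<^sup>+\<omega>. (if grid_crossing n c (\<lambda>t. B t \<omega> - v) then 1 else 0) \<partial>M)"
    unfolding P_def
    by (rule nn_integral_cong)
      (rule grid_crossing_decomposition[symmetric, where b = "\<lambda>t. B t _ - v" and F = "\<lambda>_. 1"])
  finally show ?thesis .
qed

text \<open>Both sides of the grid identity converge by dominated convergence. On the right, the
  shifted path starts below 0, so on fine grids it has a crossing as soon as it ends above
  \<open>c\<close>.\<close>

lemma nn_integral_crossing_lim_weight:
  fixes c v :: real
  assumes v: "v > 0"
  shows "(\<integral>\<^sup>+\<omega>. ennreal (if c < B 1 \<omega> \<and> 0 < crossing_lim c (\<lambda>t. B t \<omega>)
      then exp (- v * c / sqrt (crossing_lim c (\<lambda>t. B t \<omega>)) - v\<^sup>2 / (2 * crossing_lim c (\<lambda>t. B t \<omega>))) else 0) \<partial>M)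
    = (\<integral>\<^sup>+\<omega>. ennreal (if c + v < B 1 \<omega> then 1 else 0) \<partial>M)"
proof (rule LIMSEQ_unique)
  let ?w = "\<lambda>n \<omega>. if grid_crossing n c (\<lambda>t. B t \<omega>)
      then ennreal (exp (- v * B (grid_last n c (\<lambda>t. B t \<omega>)) \<omega> / grid_last n c (\<lambda>t. B t \<omega>)
        - v\<^sup>2 / (2 * grid_last n c (\<lambda>t. B t \<omega>)))) else 0"
  show "(\<lambda>n. \<integral>\<^sup>+\<omega>. ?w n \<omega> \<partial>M) \<longlonglongrightarrow> (\<integral>\<^sup>+\<omega>. ennreal (if c < B 1 \<omega> \<and> 0 < crossing_lim c (\<lambda>t. B t \<omega>)
      then exp (- v * c / sqrt (crossing_lim c (\<lambda>t. B t \<omega>)) - v\<^sup>2 / (2 * crossing_lim c (\<lambda>t. B t \<omega>))) else 0) \<partial>M)"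
  proof (rule nn_integral_dominated_convergence)
    show "?w n \<in> borel_measurable M" for n
    proof -
      have "(\<lambda>\<omega>. ennreal (exp (- v * B (real k / 2 ^ n) \<omega> / (real k / 2 ^ n) - v\<^sup>2 / (2 * (real k / 2 ^ n)))))
          \<in> borel_measurable M" for k
        by measurable
      from measurable_grid_weight[where v = 0 and
          F = "\<lambda>t \<omega>. ennreal (exp (- v * B t \<omega> / t - v\<^sup>2 / (2 * t)))", OF this]
      show ?thesis
        by (simp only: diff_zero)
    qed
    show "AE \<omega> in M. ?w n \<omega> \<le> ennreal (exp ((c - 1)\<^sup>2 / 2))" for n
      using v exp_weight_le[of v "grid_last n c (\<lambda>t. B t \<omega>)" "c - 1" "B (grid_last n c (\<lambda>t. B t \<omega>)) \<omega>" for \<omega>]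
      by (intro AE_I2) (auto simp: grid_crossing_def intro!: ennreal_leI simp del: exp_le_cancel_iff)
    show "AE \<omega> in M. (\<lambda>n. ?w n \<omega>) \<longlonglongrightarrow> ennreal (if c < B 1 \<omega> \<and> 0 < crossing_lim c (\<lambda>t. B t \<omega>)
      then exp (- v * c / sqrt (crossing_lim c (\<lambda>t. B t \<omega>)) - v\<^sup>2 / (2 * crossing_lim c (\<lambda>t. B t \<omega>))) else 0)"
      using AE_continuous_01
    proof eventually_elim
      case (elim \<omega>)
      show ?case
        using tendsto_ennrealI[OF grid_weight_tendsto[OF elim, of c v]]
        by (simp add: if_distrib[of ennreal] cong: if_cong)
    qed
  qed (auto simp: emeasure_space_1)
  have "(\<lambda>n. \<integral>\<^sup>+\<omega>. (if grid_crossing n c (\<lambda>t. B t \<omega> - v) then 1 else 0) \<partial>M)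
      \<longlonglongrightarrow> (\<integral>\<^sup>+\<omega>. ennreal (if c + v < B 1 \<omega> then 1 else 0) \<partial>M)"
  proof (rule nn_integral_dominated_convergence)
    show "(\<lambda>\<omega>. if grid_crossing n c (\<lambda>t. B t \<omega> - v) then 1 else 0 :: ennreal) \<in> borel_measurable M" for n
      using measurable_grid_weight[of n "\<lambda>t \<omega>. 1" c v] by simp
    show "AE \<omega> in M. (if grid_crossing n c (\<lambda>t. B t \<omega> - v) then 1 else 0) \<le> (1::ennreal)" for n
      by (intro AE_I2) auto
    show "AE \<omega> in M. (\<lambda>n. if grid_crossing n c (\<lambda>t. B t \<omega> - v) then 1 else 0)
        \<longlonglongrightarrow> ennreal (if c + v < B 1 \<omega> then 1 else 0)"
      using AE_continuous_01 start_zero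
    proof eventually_elim
      case (elim \<omega>)
      have cont: "continuous_on {0..1} (\<lambda>t. B t \<omega> - v)"
        by (intro continuous_intros elim)
      have "crossing_lim c (\<lambda>t. B t \<omega> - v) > 0"
        by (rule crossing_lim_pos[OF cont]) (use elim v in simp)
      then have "\<forall>\<^sub>F n in sequentially. grid_crossing n c (\<lambda>t. B t \<omega> - v)" if "c + v < B 1 \<omega>"
        using that by (intro eventually_grid_crossing cont) auto
      moreover have "\<not> grid_crossing n c (\<lambda>t. B t \<omega> - v)" if "\<not> c + v < B 1 \<omega>" for n
        using that by (simp add: grid_crossing_def)
      ultimately show ?case
        by (cases "c + v < B 1 \<omega>") (auto intro!: tendsto_eventually elim: eventually_mono)
    qed
  qed (auto simp: emeasure_space_1)
  then show "(\<lambda>n. \<integral>\<^sup>+\<omega>. ?w n \<omega> \<partial>M) \<longlonglongrightarrow> (\<integral>\<^sup>+\<omega>. ennreal (if c + v < B 1 \<omega> then 1 else 0) \<partial>M)"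
    unfolding nn_integral_grid_weight .
qed

end

section \<open>Levels decreasing to \<open>c\<close>\<close>

lemma weight_limit:
  fixes v c :: real and g a :: "nat \<Rightarrow> real"
  assumes v: "v > 0" and g: "g \<longlonglongrightarrow> l" "\<And>m. g m \<ge> 0" and a: "a \<longlonglongrightarrow> c" "\<And>m. \<bar>a m\<bar> \<le> A"
  shows "(\<lambda>m. if 0 < g m then exp (- v * a m / sqrt (g m) - v\<^sup>2 / (2 * g m)) else 0)
    \<longlonglongrightarrow> (if 0 < l then exp (- v * c / sqrt l - v\<^sup>2 / (2 * l)) else 0)"
proof (cases "0 < l")
  case True
  then have "(\<lambda>m. exp (- v * a m / sqrt (g m) - v\<^sup>2 / (2 * g m)))
      \<longlonglongrightarrow> exp (- v * c / sqrt l - v\<^sup>2 / (2 * l))"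
    by (intro tendsto_intros g a) auto
  moreover have "\<forall>\<^sub>F m in sequentially. exp (- v * a m / sqrt (g m) - v\<^sup>2 / (2 * g m)) =
      (if 0 < g m then exp (- v * a m / sqrt (g m) - v\<^sup>2 / (2 * g m)) else 0)"
    using order_tendstoD(1)[OF g(1) True] by eventually_elim simp
  ultimately show ?thesis
    using True by (simp add: Lim_transform_eventually)
next
  case False
  moreover have "0 \<le> l"
    using LIMSEQ_le_const[OF g(1), of 0] g(2) by auto
  ultimately have "l = 0" by simp
  then show ?thesis
    using exp_weight_vanishes[OF v, of g a A] g a by simp
qed

context standard_brownian_motion
begin

text \<open>The limit of \<open>crossing_lim\<close> along decreasing levels is a version of the
  last crossing time on \<open>c < B 1\<close>. It stands in for \<open>last_crossing\<close>
  wherever measurability with respect to \<open>M\<close> is required.\<close>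

lemma measurable_last_crossing_above:
  obtains L where "L \<in> borel_measurable M"
    "AE \<omega> in M. c < B 1 \<omega> \<longrightarrow> L \<omega> = last_crossing B c \<omega>"
proof
  let ?L = "\<lambda>\<omega>. lim (\<lambda>m. crossing_lim (c + 1 / real (Suc m)) (\<lambda>t. B t \<omega>))"
  show "?L \<in> borel_measurable M"
    by measurable
  show "AE \<omega> in M. c < B 1 \<omega> \<longrightarrow> ?L \<omega> = last_crossing B c \<omega>"
    using AE_continuous_01
  proof eventually_elim
    case (elim \<omega>)
    show ?case
      using crossing_lim_tendsto_last_crossing[where B = B and \<omega> = \<omega> and c = c, OF elim] by (auto intro: limI)
  qed
qed

text \<open>The identity at the levels \<open>a m\<close> is passed to the limit. The weights have a
  common bound because the levels are bounded, and since the levels decrease, the strict events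
  \<open>a m + v < B 1\<close> increase to \<open>c + v < B 1\<close>.\<close>

lemma nn_integral_last_crossing_weight:
  fixes c v :: real
  assumes v: "v > 0"
  shows "(\<integral>\<^sup>+\<omega>. ennreal (if c < B 1 \<omega> \<and> 0 < last_crossing B c \<omega>
      then exp (- v * c / sqrt (last_crossing B c \<omega>) - v\<^sup>2 / (2 * last_crossing B c \<omega>)) else 0) \<partial>M)
    = (\<integral>\<^sup>+\<omega>. ennreal (if c + v < B 1 \<omega> then 1 else 0) \<partial>M)"
proof (rule LIMSEQ_unique)
  obtain L where [measurable]: "L \<in> borel_measurable M"
    and L: "AE \<omega> in M. c < B 1 \<omega> \<longrightarrow> L \<omega> = last_crossing B c \<omega>"
    by (rule measurable_last_crossing_above)
  define a where "a m = c + 1 / real (Suc m)" for m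
  have a: "a \<longlonglongrightarrow> c"
    unfolding a_def using tendsto_add[OF tendsto_const LIMSEQ_inverse_real_of_nat, of c]
    by (simp add: inverse_eq_divide)
  have a_gt: "c < a m" and a_le: "\<bar>a m\<bar> \<le> \<bar>c\<bar> + 1" for m
  proof -
    have "0 < 1 / real (Suc m)" "1 / real (Suc m) \<le> 1" by simp_all
    then show "c < a m" "\<bar>a m\<bar> \<le> \<bar>c\<bar> + 1"
      unfolding a_def by linarith+
  qed
  let ?G = "\<lambda>m \<omega>. crossing_lim (a m) (\<lambda>t. B t \<omega>)"
  let ?w = "\<lambda>m \<omega>. if a m < B 1 \<omega> \<and> 0 < ?G m \<omega>
    then exp (- v * a m / sqrt (?G m \<omega>) - v\<^sup>2 / (2 * ?G m \<omega>)) else 0"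
  let ?e = "\<lambda>l. if 0 < l then exp (- v * c / sqrt l - v\<^sup>2 / (2 * l)) else 0"
  have "(\<lambda>m. \<integral>\<^sup>+\<omega>. ennreal (?w m \<omega>) \<partial>M) \<longlonglongrightarrow> (\<integral>\<^sup>+\<omega>. ennreal (if c < B 1 \<omega> then ?e (L \<omega>) else 0) \<partial>M)"
  proof (rule nn_integral_dominated_convergence)
    show "AE \<omega> in M. ennreal (?w m \<omega>) \<le> ennreal (exp ((\<bar>c\<bar> + 1)\<^sup>2 / 2))" for m
    proof (intro AE_I2 ennreal_leI)
      fix \<omega>
      have "exp (- v * a m / sqrt g - v\<^sup>2 / (2 * g)) \<le> exp ((\<bar>c\<bar> + 1)\<^sup>2 / 2)" if "g > 0" for g
      proof -
        have "exp (- v * (a m * sqrt g) / g - v\<^sup>2 / (2 * g)) \<le> exp ((a m)\<^sup>2 / 2)"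
          using v that by (intro exp_weight_le) auto
        also have "- v * (a m * sqrt g) / g = - v * a m / sqrt g"
          using that by (simp add: real_div_sqrt field_simps)
        also have "exp ((a m)\<^sup>2 / 2) \<le> exp ((\<bar>c\<bar> + 1)\<^sup>2 / 2)"
          using a_le[of m] by (simp add: abs_le_square_iff[symmetric])
        finally show ?thesis .
      qed
      then show "?w m \<omega> \<le> exp ((\<bar>c\<bar> + 1)\<^sup>2 / 2)"
        by simp
    qed
    show "AE \<omega> in M. (\<lambda>m. ennreal (?w m \<omega>)) \<longlonglongrightarrow> ennreal (if c < B 1 \<omega> then ?e (L \<omega>) else 0)"
      using AE_continuous_01 L
    proof eventually_elim
      case (elim \<omega>)
      show ?case
      proof (cases "c < B 1 \<omega>")
        case True
        have lim: "(\<lambda>m. ?G m \<omega>) \<longlonglongrightarrow> L \<omega>"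
          unfolding a_def using elim True
            crossing_lim_tendsto_last_crossing[where B = B and \<omega> = \<omega> and c = c, OF elim(1) True] by simp
        have "(\<lambda>m. if 0 < ?G m \<omega> then exp (- v * a m / sqrt (?G m \<omega>) - v\<^sup>2 / (2 * ?G m \<omega>)) else 0)
            \<longlonglongrightarrow> ?e (L \<omega>)"
          by (rule weight_limit[OF v lim crossing_lim_nonneg a a_le])
        moreover have "\<forall>\<^sub>F m in sequentially.
            (if 0 < ?G m \<omega> then exp (- v * a m / sqrt (?G m \<omega>) - v\<^sup>2 / (2 * ?G m \<omega>)) else 0) = ?w m \<omega>"
          using order_tendstoD(2)[OF a True] by eventually_elim simp
        ultimately have "(\<lambda>m. ?w m \<omega>) \<longlonglongrightarrow> ?e (L \<omega>)"
          by (rule Lim_transform_eventually)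
        then show ?thesis
          using True by (intro tendsto_ennrealI) simp
      next
        case False
        then have "?w m \<omega> = 0" for m
          using a_gt[of m] by auto
        then show ?thesis using False by simp
      qed
    qed
  qed (auto simp: emeasure_space_1)
  also have "(\<integral>\<^sup>+\<omega>. ennreal (if c < B 1 \<omega> then ?e (L \<omega>) else 0) \<partial>M) =
      (\<integral>\<^sup>+\<omega>. ennreal (if c < B 1 \<omega> \<and> 0 < last_crossing B c \<omega>
      then exp (- v * c / sqrt (last_crossing B c \<omega>) - v\<^sup>2 / (2 * last_crossing B c \<omega>)) else 0) \<partial>M)"
    by (intro nn_integral_cong_AE eventually_mono[OF L]) auto
  finally show "(\<lambda>m. \<integral>\<^sup>+\<omega>. ennreal (?w m \<omega>) \<partial>M) \<longlonglongrightarrow>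
      (\<integral>\<^sup>+\<omega>. ennreal (if c < B 1 \<omega> \<and> 0 < last_crossing B c \<omega>
      then exp (- v * c / sqrt (last_crossing B c \<omega>) - v\<^sup>2 / (2 * last_crossing B c \<omega>)) else 0) \<partial>M)" .
  have "(\<lambda>m. \<integral>\<^sup>+\<omega>. ennreal (if a m + v < B 1 \<omega> then 1 else 0) \<partial>M)
      \<longlonglongrightarrow> (\<integral>\<^sup>+\<omega>. ennreal (if c + v < B 1 \<omega> then 1 else 0) \<partial>M)"
  proof (rule nn_integral_dominated_convergence)
    show "AE \<omega> in M. ennreal (if a m + v < B 1 \<omega> then 1 else 0) \<le> 1" for m
      by (intro AE_I2) auto
    show "AE \<omega> in M. (\<lambda>m. ennreal (if a m + v < B 1 \<omega> then 1 else 0)) \<longlonglongrightarrow> ennreal (if c + v < B 1 \<omega> then 1 else 0)"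
    proof (intro AE_I2 tendsto_ennrealI tendsto_eventually)
      fix \<omega>
      show "\<forall>\<^sub>F m in sequentially. (if a m + v < B 1 \<omega> then 1 else 0) = (if c + v < B 1 \<omega> then 1 else 0 :: real)"
      proof (cases "c + v < B 1 \<omega>")
        case True
        then have "c < B 1 \<omega> - v" by simp
        with a have "\<forall>\<^sub>F m in sequentially. a m < B 1 \<omega> - v"
          by (rule order_tendstoD)
        then show ?thesis
          by (rule eventually_mono) (use True in auto)
      next
        case False
        then have "\<not> a m + v < B 1 \<omega>" for m
          using a_gt[of m] by linarith
        then show ?thesis using False by simp
      qed
    qed
  qed (auto simp: emeasure_space_1)
  then show "(\<lambda>m. \<integral>\<^sup>+\<omega>. ennreal (?w m \<omega>) \<partial>M) \<longlonglongrightarrow> (\<integral>\<^sup>+\<omega>. ennreal (if c + v < B 1 \<omega> then 1 else 0) \<partial>M)"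
    unfolding nn_integral_crossing_lim_weight[OF v] .
qed

section \<open>Integration over the shift \<open>v\<close>\<close>

text \<open>Tonelli turns the tail probabilities into the moment of order \<open>p\<close> of the
  positive part of \<open>B 1 - c\<close>, divided by \<open>p\<close>. Translating the normal
  density by \<open>c\<close> then produces the integrand of \<open>H (p + 1) c\<close>.\<close>

lemma nn_integral_tail:
  fixes c p :: real
  assumes p: "p > 0"
  shows "(\<integral>\<^sup>+v. ennreal (v powr (p - 1)) * indicator {0<..} v *
      (\<integral>\<^sup>+\<omega>. ennreal (if c + v < B 1 \<omega> then 1 else 0) \<partial>M) \<partial>lborel)
    = ennreal (exp (- c\<^sup>2 / 2) / sqrt (2 * pi) * H (p + 1) c / p)"
proof -
  have inner: "(\<integral>\<^sup>+v. ennreal (v powr (p - 1)) * indicator {0<..} v * ennreal (if v < y then 1 else 0) \<partial>lborel)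
      = ennreal (y powr p / p) * indicator {0<..} y" (is "?l = _") for y :: real
  proof (cases "y > 0")
    case True
    have "?l = (\<integral>\<^sup>+v. ennreal (v powr (p - 1)) * indicator {0..y} v \<partial>lborel)"
    proof (rule nn_integral_cong_AE)
      have "AE v in lborel. v \<noteq> 0 \<and> v \<noteq> y"
        by (intro AE_conjI AE_lborel_singleton)
      then show "AE v in lborel. ennreal (v powr (p - 1)) * indicator {0<..} v * ennreal (if v < y then 1 else 0)
          = ennreal (v powr (p - 1)) * indicator {0..y} v"
        by eventually_elim (auto simp: indicator_def)
    qed
    also have "\<dots> = ennreal (y powr (p - 1 + 1) / (p - 1 + 1))"
      using p True by (intro nn_integral_has_integral_lebesgue' has_integral_powr_from_0) auto
    finally show ?thesis using True by simp
  next
    case False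
    then have "?l = (\<integral>\<^sup>+v. 0 \<partial>lborel :: real measure)"
      by (intro nn_integral_cong) (auto simp: indicator_def)
    then show ?thesis using False by simp
  qed
  have "distributed M lborel (\<lambda>\<omega>. B 1 \<omega> - B 0 \<omega>) (\<lambda>x. ennreal (std_normal_density x))"
    using normal_increments[of 0 1] by simp
  note B1 = distributed_nn_integral[OF this]
  have "(\<integral>\<^sup>+v. ennreal (v powr (p - 1)) * indicator {0<..} v *
      (\<integral>\<^sup>+\<omega>. ennreal (if c + v < B 1 \<omega> then 1 else 0) \<partial>M) \<partial>lborel)
    = (\<integral>\<^sup>+v. (\<integral>\<^sup>+\<omega>. ennreal (v powr (p - 1)) * indicator {0<..} v * ennreal (if v < B 1 \<omega> - c then 1 else 0) \<partial>M) \<partial>lborel)"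
    by (subst nn_integral_cmult[symmetric]) (auto simp: less_diff_eq add.commute)
  also have "\<dots> = (\<integral>\<^sup>+\<omega>. ennreal ((B 1 \<omega> - c) powr p / p) * indicator {0<..} (B 1 \<omega> - c) \<partial>M)"
    unfolding inner[symmetric]
  proof -
    interpret pair_sigma_finite lborel M
      by (intro pair_sigma_finite.intro) (auto intro: sigma_finite_measure_axioms lborel.sigma_finite_measure_axioms)
    show "(\<integral>\<^sup>+v. (\<integral>\<^sup>+\<omega>. ennreal (v powr (p - 1)) * indicator {0<..} v * ennreal (if v < B 1 \<omega> - c then 1 else 0) \<partial>M) \<partial>lborel)
      = (\<integral>\<^sup>+\<omega>. (\<integral>\<^sup>+v. ennreal (v powr (p - 1)) * indicator {0<..} v * ennreal (if v < B 1 \<omega> - c then 1 else 0) \<partial>lborel) \<partial>M)"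
      by (rule Fubini'[symmetric]) measurable
  qed
  also have "\<dots> = (\<integral>\<^sup>+\<omega>. ennreal ((B 1 \<omega> - B 0 \<omega> - c) powr p / p) * indicator {0<..} (B 1 \<omega> - B 0 \<omega> - c) \<partial>M)"
    by (intro nn_integral_cong_AE eventually_mono[OF start_zero]) auto
  also have "\<dots> = (\<integral>\<^sup>+x. ennreal (std_normal_density x) * (ennreal ((x - c) powr p / p) * indicator {0<..} (x - c)) \<partial>lborel)"
    by (rule B1[symmetric]) measurable
  also have "\<dots> = (\<integral>\<^sup>+y. ennreal (std_normal_density (c + 1 * y)) * (ennreal ((c + 1 * y - c) powr p / p) * indicator {0<..} (c + 1 * y - c)) \<partial>lborel)"
    by (subst nn_integral_real_affine[where c = 1 and t = c]) auto
  also have "\<dots> = (\<integral>\<^sup>+y. ennreal (exp (- c\<^sup>2 / 2) / sqrt (2 * pi) / p) *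
      (ennreal (exp (- c * y - y\<^sup>2 / 2) * y powr (p + 1 - 1)) * indicator {0<..} y) \<partial>lborel)"
  proof (rule nn_integral_cong)
    fix y :: real
    have "exp (- (c + y)\<^sup>2 / 2) = exp (- c\<^sup>2 / 2) * exp (- c * y - y\<^sup>2 / 2)"
      by (simp add: power2_eq_square field_simps flip: exp_add)
    then have "std_normal_density (c + y) * (y powr p / p) =
        exp (- c\<^sup>2 / 2) / sqrt (2 * pi) / p * (exp (- c * y - y\<^sup>2 / 2) * y powr (p + 1 - 1))"
      by (simp add: std_normal_density_def)
    then show "ennreal (std_normal_density (c + 1 * y)) * (ennreal ((c + 1 * y - c) powr p / p) * indicator {0<..} (c + 1 * y - c))
      = ennreal (exp (- c\<^sup>2 / 2) / sqrt (2 * pi) / p) *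
      (ennreal (exp (- c * y - y\<^sup>2 / 2) * y powr (p + 1 - 1)) * indicator {0<..} y)"
      using p by (simp add: mult.assoc[symmetric] flip: ennreal_mult)
  qed
  also have "\<dots> = ennreal (exp (- c\<^sup>2 / 2) / sqrt (2 * pi) / p) * ennreal (H (p + 1) c)"
    using p nn_integral_H[of "p + 1" c] by (subst nn_integral_cmult) auto
  also have "\<dots> = ennreal (exp (- c\<^sup>2 / 2) / sqrt (2 * pi) * H (p + 1) c / p)"
    using p by (simp add: H_nonneg flip: ennreal_mult)
  finally show ?thesis .
qed

lemma nn_integral_last_crossing_above:
  fixes c q :: real
  assumes q: "q > 0"
  shows "(\<integral>\<^sup>+\<omega>. ennreal (if c < B 1 \<omega> then last_crossing B c \<omega> powr q else 0) \<partial>M)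
    = ennreal (exp (- c\<^sup>2 / 2) / sqrt (2 * pi) / (2 * q) * (H (2 * q + 1) c / H (2 * q) c))"
proof -
  obtain L where [measurable]: "L \<in> borel_measurable M"
    and L: "AE \<omega> in M. c < B 1 \<omega> \<longrightarrow> L \<omega> = last_crossing B c \<omega>"
    by (rule measurable_last_crossing_above)
  define e where "e v l = exp (- v * c / sqrt l - v\<^sup>2 / (2 * l))" for v l
  have [measurable]: "(\<lambda>(v, l). e v l) \<in> borel_measurable (borel \<Otimes>\<^sub>M borel)"
    unfolding e_def by measurable
  let ?p = "\<lambda>v::real. ennreal (v powr (2 * q - 1)) * indicator {0<..} v"
  interpret pair_sigma_finite lborel M
    by (intro pair_sigma_finite.intro) (auto intro: sigma_finite_measure_axioms lborel.sigma_finite_measure_axioms)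
  have inner: "(\<integral>\<^sup>+v. ?p v * ennreal (if c < B 1 \<omega> \<and> 0 < l then e v l else 0) \<partial>lborel)
      = ennreal (if c < B 1 \<omega> \<and> 0 < l then l powr q else 0) * ennreal (H (2 * q) c)" for \<omega> l
  proof (cases "c < B 1 \<omega> \<and> 0 < l")
    case True
    then have "(\<integral>\<^sup>+v. ?p v * ennreal (if c < B 1 \<omega> \<and> 0 < l then e v l else 0) \<partial>lborel)
      = (\<integral>\<^sup>+v. ennreal (v powr (2 * q - 1) * exp (- v * c / sqrt l - v\<^sup>2 / (2 * l))) * indicator {0<..} v \<partial>lborel)"
      by (intro nn_integral_cong) (simp add: e_def ennreal_mult mult_ac)
    also have "\<dots> = ennreal (l powr q * H (2 * q) c)"
      using nn_integral_H_scaled[of l "2 * q" c] True q by simp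
    finally show ?thesis using True by (simp add: ennreal_mult H_nonneg)
  qed auto
  have "(\<integral>\<^sup>+\<omega>. ennreal (if c < B 1 \<omega> then last_crossing B c \<omega> powr q else 0) \<partial>M) * ennreal (H (2 * q) c)
      = (\<integral>\<^sup>+\<omega>. ennreal (if c < B 1 \<omega> \<and> 0 < L \<omega> then L \<omega> powr q else 0) \<partial>M) * ennreal (H (2 * q) c)"
  proof -
    \<comment> \<open>Paths with last crossing time 0 may be dropped, because
      \<open>0 powr q = 0\<close>.\<close>
    have "l powr q = (if 0 < l then l powr q else 0)" if "0 \<le> l" for l :: real
      using that by auto
    note * = this[OF last_crossing_bounds(1)[of B c]]
    show ?thesis
      by (intro arg_cong2[where f = "(*)"] refl nn_integral_cong_AE eventually_mono[OF L]) (subst *, auto)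
  qed
  also have "\<dots> = (\<integral>\<^sup>+\<omega>. (\<integral>\<^sup>+v. ?p v * ennreal (if c < B 1 \<omega> \<and> 0 < L \<omega> then e v (L \<omega>) else 0) \<partial>lborel) \<partial>M)"
    unfolding inner by (rule nn_integral_multc[symmetric]) measurable
  also have "\<dots> = (\<integral>\<^sup>+v. (\<integral>\<^sup>+\<omega>. ?p v * ennreal (if c < B 1 \<omega> \<and> 0 < L \<omega> then e v (L \<omega>) else 0) \<partial>M) \<partial>lborel)"
    by (rule Fubini') measurable
  also have "\<dots> = (\<integral>\<^sup>+v. ?p v * (\<integral>\<^sup>+\<omega>. ennreal (if c < B 1 \<omega> \<and> 0 < L \<omega> then e v (L \<omega>) else 0) \<partial>M) \<partial>lborel)"
    by (intro nn_integral_cong nn_integral_cmult) measurable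
  also have "\<dots> = (\<integral>\<^sup>+v. ?p v * (\<integral>\<^sup>+\<omega>. ennreal (if c + v < B 1 \<omega> then 1 else 0) \<partial>M) \<partial>lborel)"
  proof (rule nn_integral_cong)
    fix v :: real
    have "(\<integral>\<^sup>+\<omega>. ennreal (if c < B 1 \<omega> \<and> 0 < L \<omega> then e v (L \<omega>) else 0) \<partial>M)
        = (\<integral>\<^sup>+\<omega>. ennreal (if c + v < B 1 \<omega> then 1 else 0) \<partial>M)" if "v > 0"
      unfolding nn_integral_last_crossing_weight[OF that, symmetric] e_def
      by (intro nn_integral_cong_AE eventually_mono[OF L]) auto
    then show "?p v * (\<integral>\<^sup>+\<omega>. ennreal (if c < B 1 \<omega> \<and> 0 < L \<omega> then e v (L \<omega>) else 0) \<partial>M)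
        = ?p v * (\<integral>\<^sup>+\<omega>. ennreal (if c + v < B 1 \<omega> then 1 else 0) \<partial>M)"
      by (cases "v > 0") auto
  qed
  also have "\<dots> = ennreal (exp (- c\<^sup>2 / 2) / sqrt (2 * pi) * H (2 * q + 1) c / (2 * q))"
    using nn_integral_tail[of "2 * q" c] q by simp
  also have "\<dots> = ennreal (exp (- c\<^sup>2 / 2) / sqrt (2 * pi) / (2 * q) * (H (2 * q + 1) c / H (2 * q) c)) * ennreal (H (2 * q) c)"
    using q H_pos[of "2 * q" c] by (simp add: H_nonneg flip: ennreal_mult)
  finally show ?thesis
    using H_pos[of "2 * q" c] q by (simp add: mult_right_ennreal_cancel)
qed

end

section \<open>Moments of the last crossing time\<close>

text \<open>A preimage under \<open>f\<close> is a measurable set, taken from \<open>g\<close> off a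
  null set, together with a subset of that null set.\<close>

lemma borel_measurable_completion_cong_AE:
  fixes f g :: "'a \<Rightarrow> 'b::topological_space"
  assumes g: "g \<in> borel_measurable M" and AE: "AE x in M. f x = g x"
  shows "f \<in> borel_measurable (completion M)"
proof (rule measurableI)
  fix A :: "'b set" assume A: "A \<in> sets borel"
  from AE obtain N where N: "N \<in> null_sets M" "{x \<in> space M. f x \<noteq> g x} \<subseteq> N"
    unfolding eventually_ae_filter by auto
  show "f -` A \<inter> space (completion M) \<in> sets (completion M)"
  proof (rule sets_completionI)
    show "f -` A \<inter> space (completion M) = (g -` A \<inter> space M - N) \<union> (f -` A \<inter> space M \<inter> N)"
      using N(2) by auto
    show "g -` A \<inter> space M - N \<in> sets M"
      using measurable_sets[OF g A] N(1) by auto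
  qed (use N in auto)
qed simp

lemma last_crossing_uminus: "last_crossing (\<lambda>t \<omega>. - B t \<omega>) (- c) = last_crossing B c"
  by (auto simp: last_crossing_def fun_eq_iff)

context standard_brownian_motion
begin

lemma standard_brownian_motion_uminus: "standard_brownian_motion M (\<lambda>t \<omega>. - B t \<omega>)"
proof
  show "(\<lambda>\<omega>. - B t \<omega>) \<in> borel_measurable M" if "0 \<le> t" for t
    using random_variable_B[OF that] by simp
  show "AE \<omega> in M. - B 0 \<omega> = 0"
    using start_zero by simp
  show "indep_vars (\<lambda>_. borel) (\<lambda>i \<omega>. - B (\<tau> (Suc i)) \<omega> - - B (\<tau> i) \<omega>) {..<n}"
    if "0 \<le> \<tau> 0" "\<And>i. i < n \<Longrightarrow> \<tau> i \<le> \<tau> (Suc i)" for \<tau> :: "nat \<Rightarrow> real" and n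
    using indep_vars_compose2[OF indep_increments[of \<tau> n, OF that], of "\<lambda>_ x. - x" "\<lambda>_. borel"] by simp
  show "distributed M lborel (\<lambda>\<omega>. - B t \<omega> - - B s \<omega>) (\<lambda>x. ennreal (normal_density 0 (sqrt (t - s)) x))"
    if "0 \<le> s" "s < t" for s t
    using normal_density_affine[OF normal_increments[OF that], of "-1" 0] that by simp
  show "AE \<omega> in M. continuous_on {0..} (\<lambda>t. - B t \<omega>)"
    using continuous_paths by eventually_elim (intro continuous_intros)
qed

lemma AE_B1_neq: "AE \<omega> in M. B 1 \<omega> \<noteq> c"
proof -
  have D: "distributed M lborel (\<lambda>\<omega>. B 1 \<omega> - B 0 \<omega>) (\<lambda>x. ennreal (std_normal_density x))"
    using normal_increments[of 0 1] by simp
  have "AE x in lborel. x \<noteq> c"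
    by (rule AE_lborel_singleton)
  then have "AE x in density lborel (\<lambda>x. ennreal (std_normal_density x)). x \<noteq> c"
    by (subst AE_density) auto
  then have "AE x in distr M lborel (\<lambda>\<omega>. B 1 \<omega> - B 0 \<omega>). x \<noteq> c"
    by (simp only: distributed_distr_eq_density[OF D])
  then have "AE \<omega> in M. B 1 \<omega> - B 0 \<omega> \<noteq> c"
    by (subst (asm) AE_distr_iff) auto
  then show ?thesis
    using start_zero by eventually_elim simp
qed

text \<open>Up to the null event \<open>B 1 = c\<close>, paths end above or below the boundary.
  Those ending below are handled by \<open>- B\<close> at level \<open>- c\<close>, which has the
  same last crossing time.\<close>

lemma last_crossing_moment_eq_ratios:
  fixes c q :: real
  assumes q: "q > 0"
  shows "last_crossing_moment M B c q = exp (- c\<^sup>2 / 2) / sqrt (2 * pi) / (2 * q) *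
    (H (2 * q + 1) c / H (2 * q) c + H (2 * q + 1) (- c) / H (2 * q) (- c))"
proof -
  interpret neg: standard_brownian_motion M "\<lambda>t \<omega>. - B t \<omega>"
    by (rule standard_brownian_motion_uminus)
  obtain L where [measurable]: "L \<in> borel_measurable M"
    and L: "AE \<omega> in M. c < B 1 \<omega> \<longrightarrow> L \<omega> = last_crossing B c \<omega>"
    by (rule measurable_last_crossing_above)
  obtain L' where [measurable]: "L' \<in> borel_measurable M"
    and L': "AE \<omega> in M. - c < - B 1 \<omega> \<longrightarrow> L' \<omega> = last_crossing B c \<omega>"
    using neg.measurable_last_crossing_above[of "- c"] unfolding last_crossing_uminus by blast
  let ?C = "exp (- c\<^sup>2 / 2) / sqrt (2 * pi) / (2 * q)"
  let ?R = "\<lambda>c. H (2 * q + 1) c / H (2 * q) c"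
  have R: "0 \<le> ?R x" for x
    by (simp add: H_nonneg)
  have "AE \<omega> in M. last_crossing B c \<omega> = (if c < B 1 \<omega> then L \<omega> else L' \<omega>)"
    using AE_B1_neq[of c] L L' by eventually_elim auto
  \<comment> \<open>The Bochner integral of a nonmeasurable function defaults to 0, so measurability
    has to precede the passage to the nonnegative integral.\<close>
  then have "last_crossing B c \<in> borel_measurable (completion M)"
    by (rule borel_measurable_completion_cong_AE[rotated]) measurable
  then have "last_crossing_moment M B c q
      = enn2real (\<integral>\<^sup>+\<omega>. ennreal (last_crossing B c \<omega> powr q) \<partial>completion M)"
    unfolding last_crossing_moment_def by (intro integral_eq_nn_integral) auto
  also have "(\<integral>\<^sup>+\<omega>. ennreal (last_crossing B c \<omega> powr q) \<partial>completion M)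
      = (\<integral>\<^sup>+\<omega>. ennreal (if c < B 1 \<omega> then L \<omega> powr q else 0)
        + ennreal (if - c < - B 1 \<omega> then L' \<omega> powr q else 0) \<partial>M)"
    unfolding nn_integral_completion
  proof (rule nn_integral_cong_AE)
    show "AE \<omega> in M. ennreal (last_crossing B c \<omega> powr q) = ennreal (if c < B 1 \<omega> then L \<omega> powr q else 0)
        + ennreal (if - c < - B 1 \<omega> then L' \<omega> powr q else 0)"
      using AE_B1_neq[of c] L L' by eventually_elim auto
  qed
  also have "\<dots> = (\<integral>\<^sup>+\<omega>. ennreal (if c < B 1 \<omega> then L \<omega> powr q else 0) \<partial>M)
        + (\<integral>\<^sup>+\<omega>. ennreal (if - c < - B 1 \<omega> then L' \<omega> powr q else 0) \<partial>M)"
    by (rule nn_integral_add) measurable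
  also have "(\<integral>\<^sup>+\<omega>. ennreal (if c < B 1 \<omega> then L \<omega> powr q else 0) \<partial>M)
      = (\<integral>\<^sup>+\<omega>. ennreal (if c < B 1 \<omega> then last_crossing B c \<omega> powr q else 0) \<partial>M)"
    by (intro nn_integral_cong_AE eventually_mono[OF L]) auto
  also have "\<dots> = ennreal (?C * ?R c)"
    by (rule nn_integral_last_crossing_above[OF q])
  also have "(\<integral>\<^sup>+\<omega>. ennreal (if - c < - B 1 \<omega> then L' \<omega> powr q else 0) \<partial>M)
      = (\<integral>\<^sup>+\<omega>. ennreal (if - c < - B 1 \<omega> then last_crossing B c \<omega> powr q else 0) \<partial>M)"
    by (intro nn_integral_cong_AE eventually_mono[OF L']) auto
  also have "\<dots> = ennreal (?C * ?R (- c))"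
    using neg.nn_integral_last_crossing_above[OF q, of "- c"]
    unfolding last_crossing_uminus power2_minus .
  also have "ennreal (?C * ?R c) + ennreal (?C * ?R (- c)) = ennreal (?C * (?R c + ?R (- c)))"
    using q R[of c] R[of "- c"] unfolding distrib_left
    by (intro ennreal_plus[symmetric] mult_nonneg_nonneg) auto
  also have "enn2real \<dots> = ?C * (?R c + ?R (- c))"
    using q R[of c] R[of "- c"] by (intro enn2real_ennreal mult_nonneg_nonneg add_nonneg_nonneg) auto
  finally show ?thesis .
qed

end

section \<open>Closed form and asymptotics of the moments\<close>

theorem proposition1:
  fixes M :: "'a measure" and B :: "real \<Rightarrow> 'a \<Rightarrow> real" and c :: real
  assumes "standard_brownian_motion M B"
  shows "(\<forall>q::real. q > 0 \<longrightarrow>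
            last_crossing_moment M B c q
              = Gamma (2 * q) / (2 * q * H (2 * q) c * H (2 * q) (- c)))
       \<and> (\<lambda>q. last_crossing_moment M B c q)
            \<sim>[at_top] (\<lambda>q::real. exp (- c\<^sup>2 / 2) / sqrt (pi * q))"
proof (intro conjI allI impI)
  note ratios = standard_brownian_motion.last_crossing_moment_eq_ratios[OF assms]
  fix q :: real assume q: "q > 0"
  \<comment> \<open>The numerator of the sum of the two ratios over a common denominator, which is
    the Wronskian expression.\<close>
  define N where "N = H (2 * q + 1) c * H (2 * q) (- c) + H (2 * q + 1) (- c) * H (2 * q) c"
  have N: "N = sqrt (2 * pi) * exp (c\<^sup>2 / 2) * Gamma (2 * q)"
    unfolding N_def using H_wronskian[of "2 * q" c] q by simp
  have pos: "H (2 * q) c > 0" "H (2 * q) (- c) > 0"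
    using q by (simp_all add: H_pos)
  have "last_crossing_moment M B c q
      = exp (- c\<^sup>2 / 2) / sqrt (2 * pi) / (2 * q) * (N / (H (2 * q) c * H (2 * q) (- c)))"
    unfolding ratios[OF q] N_def using pos by (simp add: add_frac_eq)
  also have "\<dots> = exp (- c\<^sup>2 / 2) * exp (c\<^sup>2 / 2) * (Gamma (2 * q) / (2 * q * H (2 * q) c * H (2 * q) (- c)))"
    unfolding N by simp
  also have "\<dots> = Gamma (2 * q) / (2 * q * H (2 * q) c * H (2 * q) (- c))"
    by (simp flip: exp_add)
  finally show "last_crossing_moment M B c q = Gamma (2 * q) / (2 * q * H (2 * q) c * H (2 * q) (- c))" .
next
  note ratios = standard_brownian_motion.last_crossing_moment_eq_ratios[OF assms]
  \<comment> \<open>The asymptotics are read off the sum of ratios, each equivalent to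
    \<open>sqrt (2 * q)\<close>, instead of the closed form.\<close>
  let ?R = "\<lambda>x q. H (2 * q + 1) x / H (2 * q) x / sqrt (2 * q)"
  have lim: "((\<lambda>q. ?R x q) \<longlongrightarrow> 1) at_top" for x
    by (rule filterlim_compose[OF H_ratio_asymptotics])
      (intro filterlim_tendsto_pos_mult_at_top[OF tendsto_const] filterlim_ident, simp)
  have "((\<lambda>q. (?R c q + ?R (- c) q) / 2) \<longlongrightarrow> (1 + 1) / 2) at_top"
    by (intro tendsto_intros lim) simp
  then have "((\<lambda>q. (?R c q + ?R (- c) q) / 2) \<longlongrightarrow> 1) at_top"
    by simp
  moreover have "\<forall>\<^sub>F q in at_top. (?R c q + ?R (- c) q) / 2
      = last_crossing_moment M B c q / (exp (- c\<^sup>2 / 2) / sqrt (pi * q))"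
    using eventually_gt_at_top[of 0]
  proof eventually_elim
    case (elim q)
    have "sqrt (2 * pi) * (2 * q) = 2 * (sqrt (2 * q) * sqrt (pi * q))"
      using elim by (simp add: real_sqrt_mult)
    then have "exp (- c\<^sup>2 / 2) / sqrt (2 * pi) / (2 * q) * r / (exp (- c\<^sup>2 / 2) / sqrt (pi * q))
        = r / sqrt (2 * q) / 2" for r
      using elim by (simp add: divide_simps)
    then show ?case
      unfolding ratios[OF elim] by (simp add: add_divide_distrib)
  qed
  ultimately have "((\<lambda>q. last_crossing_moment M B c q / (exp (- c\<^sup>2 / 2) / sqrt (pi * q))) \<longlongrightarrow> 1) at_top"
    by (rule Lim_transform_eventually)
  then show "(\<lambda>q. last_crossing_moment M B c q) \<sim>[at_top] (\<lambda>q. exp (- c\<^sup>2 / 2) / sqrt (pi * q))"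
    by (rule asymp_equivI')
qed

end
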